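(* Let $(\mathcal A,\mathscr D(\mathcal A))$ be a Lévy-type operator in $\mathbb R^d$ with characteristic triplet $(a,b,\Pi)$ and let $\pi=(\nu,\mu,\rho)$ be a convenient decomposition of the Lévy kernel $\Pi$. Then for any $f\in\mathcal C_c^2(\mathbb R^d)\cap\mathscr D(\mathcal A)$ it holds $$\begin{aligned}\mathcal Af(x)=&\ (a(x)+a_\pi(x))\cdot\nabla f(x)+\tfrac12\nabla\cdot b(x)\nabla f(x)+\int_{\mathbb R^d}f(x+y)\,\nu(x,dy)-f(x)\,\nu(x,\mathbb R^d)\\&+\int_{\mathbb R^d}\partial_{y/|y|}f(x+y)\,\overline\mu(x,dy)+\int_{\mathbb R^d}\partial^2_{y/|y|}f(x+y)\,\overline{\overline\rho}(x,dy),\end{aligned}$$ where $a_\pi(x)=-\int_{|y|<1}y\,\nu(x,dy)-\int_{|y|<1}y\,\mu(x,dy)+\int_{|y|\ge1}y\,\rho(x,dy)$, and $\overline\mu$, $\overline{\overline\rho}$ denote the integrated radial tail of $\mu$ and the double-integrated radial tail of $\rho$.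
   Context: **Lévy-type operators.** Let $\mathcal E$ be a Banach space of functions $f:\mathbb R^d\to\mathbb R$. A Lévy-type operator is a pair $(\mathcal A,\mathscr D(\mathcal A))$ with $\mathscr D(\mathcal A)\subset\mathcal E$ and $\mathcal A:\mathscr D(\mathcal A)\to\mathcal E$ of the form $$\mathcal Af(x)=a(x)\cdot\nabla f(x)+\tfrac12\nabla\cdot b(x)\nabla f(x)+\int_{\mathbb R^d}\big(f(x+y)-f(x)-\nabla f(x)\cdot y\mathbf 1_{\{|y|<1\}}\big)\Pi(x,dy),$$ where $\nabla\cdot b\nabla f=\sum_{i,j}\partial_i(b_{ij}\partial_jf)$, $a:\mathbb R^d\to\mathbb R^d$ is Borel, $b$ is Borel with values in the symmetric positive semidefinite $d\times d$ matrices, and $\Pi$ is a Lévy kernel: $\Pi(x,\cdot)$ is a Lévy measure on $\mathbb R^d$ for each $x$, $\Pi(\cdot,B)$ is Borel for each Borel $B$, $\Pi(x,\{0\})=0$. $(a,b,\Pi)$ is the characteristic triplet. **Convenient decomposition.** $\pi=(\nu,\mu,\rho)$ is a convenient decomposition of $\Pi$ if there are non-negative continuous functions $h_\nu,h_\mu,h_\rho$ on $\mathbb R^d$ with $\nu=h_\nu\Pi$, $\mu=h_\mu\Pi$, $\rho=h_\rho\Pi$ (i.e. $\nu(x,dy)=h_\nu(y)\Pi(x,dy)$ etc.), $\Pi=\nu+\mu+\rho$, and for all $x$: $\nu(x,\mathbb R^d)<\infty$, $\int(1\wedge|y|)\mu(x,dy)<\infty$, $\int(|y|\wedge|y|^2)\rho(x,dy)<\infty$.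 **Integrated tails.** A polar decomposition of a $\sigma$-finite measure $Q$ on $\mathbb R^d$ with $Q(\{0\})=0$ is a finite measure $Q_o$ on the unit sphere $S^{d-1}$ and a measurable family $(Q_\xi)_{\xi\in S^{d-1}}$ of $\sigma$-finite measures on $(0,\infty)$ with $Q_\xi((0,\infty))>0$ and $Q(B)=\int_{S^{d-1}}\int_{(0,\infty)}\mathbf 1_B(r\xi)Q_\xi(dr)Q_o(d\xi)$. For a Lévy kernel $Q$ choose for each $x$ a polar decomposition of $Q(x,\cdot)$ whose radial parts are Lévy measures. The integrated radial tail is $\overline Q(x,B)=\int_{S^{d-1}}\int_{(0,\infty)}\mathbf 1_B(z\xi)\int_{(z,\infty)}Q_\xi(x,dr)\,dz\,Q_o(x,d\xi)$, and, if $\int(|y|\wedge|y|^2)Q(x,dy)<\infty$ for all $x$ (radial parts chosen with $\int(r\wedge r^2)Q_\xi(x,dr)<\infty$), the double-integrated radial tail is $\overline{\overline Q}(x,B)=\int_{S^{d-1}}\int_{(0,\infty)}\mathbf 1_B(z_2\xi)\int_{(z_2,\infty)}\int_{(z_1,\infty)}Q_\xi(x,dr)\,dz_1\,dz_2\,Q_o(x,d\xi)$. Both are independent of the choice and do not charge $\{0\}$. **Directional derivatives.** $\partial_\xi=\xi\cdot\nabla$; $\partial_{y/|y|}f(x+y)$ and $\partial^2_{y/|y|}f(x+y)$ are the first and second derivatives of $f$ at the point $x+y$ in the (fixed) direction $\xi=y/|y|$. *)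

theory Defs
  imports "HOL-Analysis.Analysis"
begin

subsection \<open>Derivatives\<close>

definition has_partial :: "'n::finite \<Rightarrow> (real^'n \<Rightarrow> real) \<Rightarrow> real^'n \<Rightarrow> bool" where
  "has_partial i f x \<longleftrightarrow> (\<lambda>t. f (x + t *\<^sub>R axis i 1)) differentiable (at 0)"

definition partial :: "'n::finite \<Rightarrow> (real^'n \<Rightarrow> real) \<Rightarrow> real^'n \<Rightarrow> real" where
  "partial i f x = deriv (\<lambda>t. f (x + t *\<^sub>R axis i 1)) 0"

definition grad :: "(real^'n::finite \<Rightarrow> real) \<Rightarrow> real^'n \<Rightarrow> real^'n" where
  "grad f x = (\<chi> i. partial i f x)"

definition dir_deriv :: "real^'n::finite \<Rightarrow> (real^'n \<Rightarrow> real) \<Rightarrow> real^'n \<Rightarrow> real" where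
  "dir_deriv \<xi> f x = \<xi> \<bullet> grad f x"

definition div_grad :: "(real^'n::finite \<Rightarrow> real^'n^'n) \<Rightarrow> (real^'n \<Rightarrow> real) \<Rightarrow> real^'n \<Rightarrow> real" where
  "div_grad b f x = (\<Sum>i\<in>UNIV. \<Sum>j\<in>UNIV. partial i (\<lambda>z. b z $ i $ j * partial j f z) x)"

text \<open>Twice continuously (Frechet) differentiable with compact support.\<close>

definition C2c :: "(real^'n::finite \<Rightarrow> real) set" where
  "C2c = {f. (\<exists>(f' :: real^'n \<Rightarrow> (real^'n) \<Rightarrow>\<^sub>L real) (f'' :: real^'n \<Rightarrow> (real^'n) \<Rightarrow>\<^sub>L ((real^'n) \<Rightarrow>\<^sub>L real)).
                (\<forall>x. (f has_derivative blinfun_apply (f' x)) (at x)) \<and>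
                (\<forall>x. (f' has_derivative blinfun_apply (f'' x)) (at x)) \<and>
                continuous_on UNIV f'') \<and>
             compact (closure {x. f x \<noteq> 0})}"


subsection \<open>Levy measures, Levy kernels and Levy-type operators\<close>

definition levy_measure :: "(real^'n::finite) measure \<Rightarrow> bool" where
  "levy_measure Q \<longleftrightarrow> sets Q = sets borel \<and> emeasure Q {0} = 0 \<and>
     (\<integral>\<^sup>+y. ennreal (min 1 ((norm y)\<^sup>2)) \<partial>Q) < \<infinity>"

definition levy_kernel :: "(real^'n::finite \<Rightarrow> (real^'n) measure) \<Rightarrow> bool" where
  "levy_kernel Q \<longleftrightarrow> (\<forall>x. levy_measure (Q x)) \<and>
     (\<forall>B\<in>sets borel. (\<lambda>x. emeasure (Q x) B) \<in> borel_measurable borel)"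

definition levy_triplet ::
  "(real^'n::finite \<Rightarrow> real^'n) \<Rightarrow> (real^'n \<Rightarrow> real^'n^'n) \<Rightarrow> (real^'n \<Rightarrow> (real^'n) measure) \<Rightarrow> bool" where
  "levy_triplet a b K \<longleftrightarrow>
     a \<in> borel_measurable borel \<and>
     b \<in> borel_measurable borel \<and>
     (\<forall>x. transpose (b x) = b x \<and> (\<forall>v. 0 \<le> v \<bullet> (b x *v v))) \<and>
     levy_kernel K"

text \<open>A Banach space whose elements are functions (not equivalence classes), with pointwise
  vector space operations; \<open>N\<close> is the norm and is only relevant on the carrier \<open>E\<close>.\<close>

definition banach_function_space ::
  "(real^'n::finite \<Rightarrow> real) set \<Rightarrow> ((real^'n \<Rightarrow> real) \<Rightarrow> real) \<Rightarrow> bool" where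
  "banach_function_space E N \<longleftrightarrow>
     (\<lambda>x. 0) \<in> E \<and>
     (\<forall>f\<in>E. \<forall>g\<in>E. (\<lambda>x. f x + g x) \<in> E) \<and>
     (\<forall>c. \<forall>f\<in>E. (\<lambda>x. c * f x) \<in> E) \<and>
     (\<forall>f\<in>E. 0 \<le> N f \<and> (N f = 0 \<longleftrightarrow> f = (\<lambda>x. 0))) \<and>
     (\<forall>c. \<forall>f\<in>E. N (\<lambda>x. c * f x) = \<bar>c\<bar> * N f) \<and>
     (\<forall>f\<in>E. \<forall>g\<in>E. N (\<lambda>x. f x + g x) \<le> N f + N g) \<and>
     (\<forall>u :: nat \<Rightarrow> real^'n \<Rightarrow> real.
        (\<forall>n. u n \<in> E) \<and>
        (\<forall>e>0. \<exists>M. \<forall>m\<ge>M. \<forall>n\<ge>M. N (\<lambda>x. u m x - u n x) < e) \<longrightarrow>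
        (\<exists>g\<in>E. (\<lambda>n. N (\<lambda>x. u n x - g x)) \<longlonglongrightarrow> 0))"

definition levy_integrand :: "(real^'n::finite \<Rightarrow> real) \<Rightarrow> real^'n \<Rightarrow> real^'n \<Rightarrow> real" where
  "levy_integrand f x y = f (x + y) - f x - (grad f x \<bullet> y) * indicator {y. norm y < 1} y"

text \<open>The Levy kernel is called \<open>K\<close>. All derivatives and the integral in the expression defining \<open>\<A>f\<close> exist for
  \<open>f \<in> \<D>(\<A>)\<close>. The first three conjuncts about \<open>f\<close> say so explicitly, because \<^const>\<open>deriv\<close> and the
  Bochner integral are total functions.\<close>

definition levy_type_operator ::
  "(real^'n::finite \<Rightarrow> real) set \<Rightarrow> ((real^'n \<Rightarrow> real) \<Rightarrow> real) \<Rightarrow>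
   (real^'n \<Rightarrow> real) set \<Rightarrow> ((real^'n \<Rightarrow> real) \<Rightarrow> (real^'n \<Rightarrow> real)) \<Rightarrow>
   (real^'n \<Rightarrow> real^'n) \<Rightarrow> (real^'n \<Rightarrow> real^'n^'n) \<Rightarrow> (real^'n \<Rightarrow> (real^'n) measure) \<Rightarrow> bool" where
  "levy_type_operator E N D A a b K \<longleftrightarrow>
     banach_function_space E N \<and> D \<subseteq> E \<and> A ` D \<subseteq> E \<and> levy_triplet a b K \<and>
     (\<forall>f\<in>D. \<forall>x.
        (\<forall>i. has_partial i f x) \<and>
        (\<forall>i j. has_partial i (\<lambda>z. b z $ i $ j * partial j f z) x) \<and>
        integrable (K x) (levy_integrand f x) \<and>
        A f x = a x \<bullet> grad f x + 1/2 * div_grad b f x + (LINT y|K x. levy_integrand f x y))"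


subsection \<open>Convenient decompositions\<close>

definition convenient_decomposition ::
  "(real^'n::finite \<Rightarrow> (real^'n) measure) \<Rightarrow> (real^'n \<Rightarrow> (real^'n) measure) \<Rightarrow>
   (real^'n \<Rightarrow> (real^'n) measure) \<Rightarrow> (real^'n \<Rightarrow> (real^'n) measure) \<Rightarrow> bool" where
  "convenient_decomposition K \<nu> \<mu> \<rho> \<longleftrightarrow>
     (\<exists>h\<^sub>\<nu> h\<^sub>\<mu> h\<^sub>\<rho> :: real^'n \<Rightarrow> real.
        continuous_on UNIV h\<^sub>\<nu> \<and> continuous_on UNIV h\<^sub>\<mu> \<and> continuous_on UNIV h\<^sub>\<rho> \<and>
        (\<forall>y. 0 \<le> h\<^sub>\<nu> y \<and> 0 \<le> h\<^sub>\<mu> y \<and> 0 \<le> h\<^sub>\<rho> y) \<and>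
        (\<forall>x. \<nu> x = density (K x) (\<lambda>y. ennreal (h\<^sub>\<nu> y)) \<and>
             \<mu> x = density (K x) (\<lambda>y. ennreal (h\<^sub>\<mu> y)) \<and>
             \<rho> x = density (K x) (\<lambda>y. ennreal (h\<^sub>\<rho> y)))) \<and>
     (\<forall>x. \<forall>B\<in>sets borel.
        emeasure (K x) B = emeasure (\<nu> x) B + emeasure (\<mu> x) B + emeasure (\<rho> x) B) \<and>
     (\<forall>x. emeasure (\<nu> x) UNIV < \<infinity> \<and>
          (\<integral>\<^sup>+y. ennreal (min 1 (norm y)) \<partial>\<mu> x) < \<infinity> \<and>
          (\<integral>\<^sup>+y. ennreal (min (norm y) ((norm y)\<^sup>2)) \<partial>\<rho> x) < \<infinity>)"

definition drift_correction ::
  "(real^'n::finite \<Rightarrow> (real^'n) measure) \<Rightarrow> (real^'n \<Rightarrow> (real^'n) measure) \<Rightarrow>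
   (real^'n \<Rightarrow> (real^'n) measure) \<Rightarrow> real^'n \<Rightarrow> real^'n" where
  "drift_correction \<nu> \<mu> \<rho> x =
     - (LINT y:{y. norm y < 1}|\<nu> x. y) - (LINT y:{y. norm y < 1}|\<mu> x. y)
     + (LINT y:{y. norm y \<ge> 1}|\<rho> x. y)"


subsection \<open>Polar decompositions and integrated radial tails\<close>

text \<open>\<open>Qo\<close> is a measure on the unit sphere and each \<open>Qr \<xi>\<close> a measure on the open half-line,
  both with the trace of the Borel sigma-algebra.\<close>

definition polar_decomposition ::
  "(real^'n::finite) measure \<Rightarrow> (real^'n) measure \<Rightarrow> (real^'n \<Rightarrow> real measure) \<Rightarrow> bool" where
  "polar_decomposition Q Qo Qr \<longleftrightarrow>
     sets Qo = sets (restrict_space borel (sphere 0 1)) \<and> finite_measure Qo \<and>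
     (\<forall>\<xi>\<in>sphere 0 1.
        sets (Qr \<xi>) = sets (restrict_space borel {0<..}) \<and>
        sigma_finite_measure (Qr \<xi>) \<and> emeasure (Qr \<xi>) {0<..} > 0) \<and>
     (\<forall>B\<in>sets (restrict_space borel {0<..}). (\<lambda>\<xi>. emeasure (Qr \<xi>) B) \<in> borel_measurable Qo) \<and>
     (\<forall>B\<in>sets borel. emeasure Q B = (\<integral>\<^sup>+\<xi>. (\<integral>\<^sup>+r. indicator B (r *\<^sub>R \<xi>) \<partial>Qr \<xi>) \<partial>Qo))"

definition radial_tail_measure ::
  "(real^'n::finite) measure \<Rightarrow> (real^'n \<Rightarrow> real measure) \<Rightarrow> (real^'n) measure" where
  "radial_tail_measure Qo Qr = measure_of UNIV (sets borel)
     (\<lambda>B. \<integral>\<^sup>+\<xi>. (\<integral>\<^sup>+z\<in>{0<..}. indicator B (z *\<^sub>R \<xi>) * emeasure (Qr \<xi>) {z<..} \<partial>lborel) \<partial>Qo)"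

definition double_radial_tail_measure ::
  "(real^'n::finite) measure \<Rightarrow> (real^'n \<Rightarrow> real measure) \<Rightarrow> (real^'n) measure" where
  "double_radial_tail_measure Qo Qr = measure_of UNIV (sets borel)
     (\<lambda>B. \<integral>\<^sup>+\<xi>. (\<integral>\<^sup>+z\<^sub>2\<in>{0<..}. indicator B (z\<^sub>2 *\<^sub>R \<xi>) *
                  (\<integral>\<^sup>+z\<^sub>1\<in>{z\<^sub>2<..}. emeasure (Qr \<xi>) {z\<^sub>1<..} \<partial>lborel) \<partial>lborel) \<partial>Qo)"

text \<open>Polar decompositions are not unique, but the tails do not depend on the choice. The tails are
  therefore introduced as relations: \<open>T\<close> is the integrated tail of \<open>Q\<close> computed from some admissible
  choice, for each \<open>x\<close>, of a polar decomposition of \<open>Q x\<close>. Assuming such a relation for a variable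
  \<open>T\<close> amounts to quantifying over all admissible choices. Joint measurability in \<open>x\<close> is not needed.\<close>

definition integrated_radial_tail ::
  "(real^'n::finite \<Rightarrow> (real^'n) measure) \<Rightarrow> (real^'n \<Rightarrow> (real^'n) measure) \<Rightarrow> bool" where
  "integrated_radial_tail Q T \<longleftrightarrow>
     (\<forall>x. \<exists>Qo Qr. polar_decomposition (Q x) Qo Qr \<and>
        (\<forall>\<xi>\<in>sphere 0 1. (\<integral>\<^sup>+r. ennreal (min 1 (r\<^sup>2)) \<partial>Qr \<xi>) < \<infinity>) \<and>
        T x = radial_tail_measure Qo Qr)"

definition double_integrated_radial_tail ::
  "(real^'n::finite \<Rightarrow> (real^'n) measure) \<Rightarrow> (real^'n \<Rightarrow> (real^'n) measure) \<Rightarrow> bool" where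
  "double_integrated_radial_tail Q T \<longleftrightarrow>
     (\<forall>x. \<exists>Qo Qr. polar_decomposition (Q x) Qo Qr \<and>
        (\<forall>\<xi>\<in>sphere 0 1. (\<integral>\<^sup>+r. ennreal (min r (r\<^sup>2)) \<partial>Qr \<xi>) < \<infinity>) \<and>
        T x = double_radial_tail_measure Qo Qr)"

end

theory Submission
  imports Defs
begin

text \<open>Both tails are images of \<open>Q \<otimes> lborel\<close>: for \<open>Q\<close> with polar decomposition, Tonelli's theorem gives
  \<open>\<integral> g d(tail) = \<integral> (\<integral>\<^sub>0\<^sup>r (r - z)^j g(z \<xi>) dz) Q(dy)\<close> where \<open>r = |y|\<close> and \<open>\<xi> = y/|y|\<close>, with \<open>j = 0\<close> for the
  integrated tail and \<open>j = 1\<close> for the double-integrated one. When \<open>g\<close> is the first (second) directional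
  derivative of \<open>f\<close> at \<open>x + y\<close>, the inner integral is the Taylor remainder \<open>f(x+y) - f(x)\<close>
  (\<open>f(x+y) - f(x) - \<nabla>f(x)\<cdot>y\<close>). Against \<open>\<nu>\<close>, \<open>\<mu>\<close>, \<open>\<rho>\<close> the compensated integrand of \<open>\<A>\<close> differs from
  \<open>f(x+y) - f(x)\<close>, \<open>f(x+y) - f(x)\<close>, \<open>f(x+y) - f(x) - \<nabla>f(x)\<cdot>y\<close> respectively only by terms
  linear in \<open>y\<close>, which make up the drift correction.\<close>

subsection \<open>Integration in polar coordinates\<close>

text \<open>By Markov's inequality the level sets where \<open>\<phi>\<close> is at least
  \<open>1 / Suc n\<close> have finite measure, and together with a null set they exhaust the space.
  Applied to the moment integrands, this supplies the sigma-finiteness on which Fubini with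
  \<open>lborel\<close> and the uniqueness of densities rest.\<close>

lemma sigma_finite_measure_nn_integral_pos:
  fixes \<phi> :: "'a \<Rightarrow> real"
  assumes [measurable]: "\<phi> \<in> borel_measurable M"
    and fin: "(\<integral>\<^sup>+y. ennreal (\<phi> y) \<partial>M) < \<infinity>"
    and pos: "AE y in M. 0 < \<phi> y"
  shows "sigma_finite_measure M"
proof
  let ?P = "\<lambda>n. {y \<in> space M. 1 \<le> ennreal (real (Suc n)) * ennreal (\<phi> y)}"
  let ?Z = "{y \<in> space M. \<not> 0 < \<phi> y}"
  have Z: "emeasure M ?Z = 0"
    using pos by (intro emeasure_eq_0_AE) auto
  have P: "emeasure M (?P n) \<noteq> \<infinity>" for n
  proof -
    have "emeasure M (?P n)
        \<le> ennreal (real (Suc n)) * (\<integral>\<^sup>+y. ennreal (\<phi> y) * indicator (space M) y \<partial>M)"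
      using nn_integral_Markov_inequality[where u="\<lambda>y. ennreal (\<phi> y)" and M=M and A="space M" and c="ennreal (real (Suc n))"]
      by (simp del: of_nat_Suc)
    also have "(\<integral>\<^sup>+y. ennreal (\<phi> y) * indicator (space M) y \<partial>M) = (\<integral>\<^sup>+y. ennreal (\<phi> y) \<partial>M)"
      by (rule nn_integral_cong) simp
    also have "ennreal (real (Suc n)) * \<dots> < \<infinity>"
      using fin by (simp add: ennreal_mult_less_top del: of_nat_Suc)
    finally show ?thesis by simp
  qed
  show "\<exists>A. countable A \<and> A \<subseteq> sets M \<and> \<Union> A = space M \<and> (\<forall>a\<in>A. emeasure M a \<noteq> \<infinity>)"
  proof (intro exI conjI)
    show "countable (insert ?Z (range ?P))" by simp
    show "insert ?Z (range ?P) \<subseteq> sets M" by auto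
    show "\<forall>a\<in>insert ?Z (range ?P). emeasure M a \<noteq> \<infinity>" using Z P by auto
    show "\<Union> (insert ?Z (range ?P)) = space M"
    proof (intro equalityI subsetI)
      fix y assume y: "y \<in> space M"
      show "y \<in> \<Union> (insert ?Z (range ?P))"
      proof (cases "0 < \<phi> y")
        case True
        then obtain n where "inverse (real (Suc n)) < \<phi> y" using reals_Archimedean by blast
        then have "1 \<le> real (Suc n) * \<phi> y" by (simp add: field_simps del: of_nat_Suc)
        then have "ennreal 1 \<le> ennreal (real (Suc n) * \<phi> y)" by (rule ennreal_leI)
        then have "y \<in> ?P n" using y by (simp add: ennreal_mult' del: of_nat_Suc)
        then show ?thesis by blast
      qed (use y in auto)
    qed auto
  qed
qed

text \<open>Only rectangles are measurable by assumption. Finiteness of the kernel on \<open>{e<..}\<close> is what makes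
  the sets with measurable sections a Dynkin system; then \<open>e \<rightarrow> 0\<close>. For merely
  sigma-finite kernels this could fail.\<close>

lemma polar_decomposition_measurable:
  fixes Q :: "(real^'n::finite) measure"
  assumes pd: "polar_decomposition Q Qo Qr"
    and fin: "\<And>\<xi> e. \<xi> \<in> sphere 0 1 \<Longrightarrow> 0 < e \<Longrightarrow> emeasure (Qr \<xi>) {e<..} < \<infinity>"
    and C: "C \<in> sets (Qo \<Otimes>\<^sub>M (borel :: real measure))"
  shows "(\<lambda>\<xi>. emeasure (Qr \<xi>) {r. 0 < r \<and> (\<xi>, r) \<in> C}) \<in> borel_measurable Qo"
proof -
  have sQo: "sets Qo = sets (restrict_space borel (sphere 0 1))"
    and sQr: "\<And>\<xi>. \<xi> \<in> sphere 0 1 \<Longrightarrow> sets (Qr \<xi>) = sets (restrict_space borel {0<..})"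
    and meas: "\<And>B. B \<in> sets (restrict_space borel {0<..}) \<Longrightarrow> (\<lambda>\<xi>. emeasure (Qr \<xi>) B) \<in> borel_measurable Qo"
    using pd unfolding polar_decomposition_def by auto
  have spQo: "space Qo = sphere 0 1"
    using sets_eq_imp_space_eq[OF sQo] by (simp add: space_restrict_space)
  have half: "B \<in> sets (restrict_space borel {0<..})" if "B \<in> sets borel" "B \<subseteq> {0<..}" for B :: "real set"
    using that by (auto simp: sets_restrict_space image_iff intro!: bexI[of _ B])
  have section_borel: "{r. (\<xi>, r) \<in> C} \<in> sets borel" if "C \<in> sets (Qo \<Otimes>\<^sub>M (borel :: real measure))" for \<xi> C
    using sets_Pair1[OF that, of \<xi>] by (simp add: vimage_def)
  have level: "(\<lambda>\<xi>. emeasure (Qr \<xi>) {r. e < r \<and> (\<xi>, r) \<in> C}) \<in> borel_measurable Qo" if e: "0 < e" for e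
  proof -
    let ?S = "\<lambda>C \<xi>. {r. e < r \<and> (\<xi>, r) \<in> C}"
    have Sset: "?S C \<xi> \<in> sets (Qr \<xi>)" if "C \<in> sets (Qo \<Otimes>\<^sub>M (borel :: real measure))" "\<xi> \<in> sphere 0 1" for C \<xi>
    proof -
      have "?S C \<xi> = {e<..} \<inter> {r. (\<xi>, r) \<in> C}" by auto
      also have "\<dots> \<in> sets borel" using section_borel[OF that(1)] by simp
      finally show ?thesis using e unfolding sQr[OF that(2)] by (intro half) auto
    qed
    show ?thesis
      using Int_stable_pair_measure_generator[of Qo borel] pair_measure_closed[of Qo borel] C
      unfolding sets_pair_measure
    proof (induction rule: sigma_sets_induct_disjoint)
      case (basic C)
      then obtain a b where C: "C = a \<times> b" "a \<in> sets Qo" "b \<in> sets (borel :: real measure)" by auto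
      \<comment> \<open>The section of a rectangle is \<open>b\<close> cut off at \<open>e\<close>
        if \<open>\<xi>\<close> lies in \<open>a\<close> and empty otherwise, so its mass is a
        product of two measurable functions.\<close>
      have "(\<lambda>\<xi>. indicator a \<xi> * emeasure (Qr \<xi>) ({e<..} \<inter> b)) \<in> borel_measurable Qo"
        using C e by (intro borel_measurable_times_ennreal borel_measurable_indicator meas half) auto
      also have "(\<lambda>\<xi>. indicator a \<xi> * emeasure (Qr \<xi>) ({e<..} \<inter> b)) = (\<lambda>\<xi>. emeasure (Qr \<xi>) (?S C \<xi>))"
        by (auto simp: C(1) indicator_def fun_eq_iff intro!: arg_cong2[where f=emeasure])
      finally show ?case .
    next
      case empty
      then show ?case by simp
    next
      case (compl C)
      then have C: "C \<in> sets (Qo \<Otimes>\<^sub>M (borel :: real measure))" by (simp add: sets_pair_measure)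
      have "(\<lambda>\<xi>. emeasure (Qr \<xi>) {e<..} - emeasure (Qr \<xi>) (?S C \<xi>)) \<in> borel_measurable Qo"
        using compl e by (intro borel_measurable_minus_ennreal meas half) auto
      also have "?this \<longleftrightarrow> ?case"
      proof (rule measurable_cong)
        fix \<xi> assume "\<xi> \<in> space Qo"
        then have \<xi>: "\<xi> \<in> sphere 0 1" by (simp add: spQo)
        have "?S (space Qo \<times> space borel - C) \<xi> = {e<..} - ?S C \<xi>"
          using \<open>\<xi> \<in> space Qo\<close> by auto
        moreover have "emeasure (Qr \<xi>) ({e<..} - ?S C \<xi>) = emeasure (Qr \<xi>) {e<..} - emeasure (Qr \<xi>) (?S C \<xi>)"
        proof (rule emeasure_Diff)
          show "emeasure (Qr \<xi>) (?S C \<xi>) \<noteq> \<infinity>"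
          proof -
            have "emeasure (Qr \<xi>) (?S C \<xi>) \<le> emeasure (Qr \<xi>) {e<..}"
              using e by (intro emeasure_mono) (auto simp: sQr[OF \<xi>] intro!: half)
            then show ?thesis using fin[OF \<xi> e] by auto
          qed
        qed (use e Sset[OF C \<xi>] in \<open>auto simp: sQr[OF \<xi>] intro!: half\<close>)
        ultimately show "emeasure (Qr \<xi>) {e<..} - emeasure (Qr \<xi>) (?S C \<xi>) = emeasure (Qr \<xi>) (?S (space Qo \<times> space borel - C) \<xi>)"
          by simp
      qed
      finally show ?case .
    next
      case (union C)
      then have C: "C i \<in> sets (Qo \<Otimes>\<^sub>M (borel :: real measure))" for i by (auto simp: sets_pair_measure)
      have "(\<lambda>\<xi>. \<Sum>i. emeasure (Qr \<xi>) (?S (C i) \<xi>)) \<in> borel_measurable Qo"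
        using union by (intro borel_measurable_suminf_order) auto
      also have "?this \<longleftrightarrow> ?case"
      proof (rule measurable_cong)
        fix \<xi> assume "\<xi> \<in> space Qo"
        then have \<xi>: "\<xi> \<in> sphere 0 1" by (simp add: spQo)
        have "(\<Sum>i. emeasure (Qr \<xi>) (?S (C i) \<xi>)) = emeasure (Qr \<xi>) (\<Union>i. ?S (C i) \<xi>)"
          using union \<xi> C by (intro suminf_emeasure) (auto simp: disjoint_family_on_def intro!: Sset)
        also have "(\<Union>i. ?S (C i) \<xi>) = ?S (\<Union>i. C i) \<xi>" by auto
        finally show "(\<Sum>i. emeasure (Qr \<xi>) (?S (C i) \<xi>)) = emeasure (Qr \<xi>) (?S (\<Union> (range C)) \<xi>)" by simp
      qed
      finally show ?case .
    qed
  qed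
  have "(\<lambda>\<xi>. SUP n. emeasure (Qr \<xi>) {r. inverse (Suc n) < r \<and> (\<xi>, r) \<in> C}) \<in> borel_measurable Qo"
    by (intro borel_measurable_SUP level) auto
  also have "?this \<longleftrightarrow> ?thesis"
  proof (rule measurable_cong)
    fix \<xi> assume "\<xi> \<in> space Qo"
    then have \<xi>: "\<xi> \<in> sphere 0 1" by (simp add: spQo)
    let ?A = "\<lambda>n::nat. {r. inverse (Suc n) < r \<and> (\<xi>, r) \<in> C}"
    have "(SUP n. emeasure (Qr \<xi>) (?A n)) = emeasure (Qr \<xi>) (\<Union>n. ?A n)"
    proof (rule SUP_emeasure_incseq)
      have "?A n = {inverse (Suc n)<..} \<inter> {r. (\<xi>, r) \<in> C}" for n by auto
      moreover have "{inverse (real (Suc n))<..} \<inter> {r. (\<xi>, r) \<in> C} \<in> sets (Qr \<xi>)" for n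
        unfolding sQr[OF \<xi>] using section_borel[OF C]
        by (intro half) (auto, smt (verit) inverse_nonnegative_iff_nonnegative of_nat_0_le_iff)
      ultimately show "range ?A \<subseteq> sets (Qr \<xi>)" by auto
      show "incseq ?A"
        by (intro incseq_SucI subsetI) (auto elim!: le_less_trans[rotated] intro!: le_imp_inverse_le)
    qed
    also have "(\<Union>n. ?A n) = {r. 0 < r \<and> (\<xi>, r) \<in> C}"
      using reals_Archimedean by (force intro: less_trans[rotated])
    finally show "(SUP n. emeasure (Qr \<xi>) (?A n)) = emeasure (Qr \<xi>) {r. 0 < r \<and> (\<xi>, r) \<in> C}" .
  qed
  finally show ?thesis .
qed

text \<open>The polar decomposition asserts the identity for Borel sets; linearity and monotone
  convergence carry it to non-negative functions.\<close>

lemma polar_decomposition_nn_integral: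
  fixes Q :: "(real^'n::finite) measure" and \<Phi> :: "real^'n \<Rightarrow> ennreal"
  assumes pd: "polar_decomposition Q Qo Qr"
    and fin: "\<And>\<xi> e. \<xi> \<in> sphere 0 1 \<Longrightarrow> 0 < e \<Longrightarrow> emeasure (Qr \<xi>) {e<..} < \<infinity>"
    and sQ: "sets Q = sets borel"
    and \<Phi>: "\<Phi> \<in> borel_measurable borel"
  shows "(\<integral>\<^sup>+y. \<Phi> y \<partial>Q) = (\<integral>\<^sup>+\<xi>. (\<integral>\<^sup>+r. \<Phi> (r *\<^sub>R \<xi>) \<partial>Qr \<xi>) \<partial>Qo)"
proof -
  have sQo: "sets Qo = sets (restrict_space borel (sphere 0 1))"
    and sQr: "\<And>\<xi>. \<xi> \<in> sphere 0 1 \<Longrightarrow> sets (Qr \<xi>) = sets (restrict_space borel {0<..})"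
    and eQ: "\<And>B. B \<in> sets borel \<Longrightarrow> emeasure Q B = (\<integral>\<^sup>+\<xi>. (\<integral>\<^sup>+r. indicator B (r *\<^sub>R \<xi>) \<partial>Qr \<xi>) \<partial>Qo)"
    using pd unfolding polar_decomposition_def by auto
  have spQo: "space Qo = sphere 0 1"
    using sets_eq_imp_space_eq[OF sQo] by (simp add: space_restrict_space)
  have [measurable_cong]: "sets Q = sets borel" by fact
  have id1: "(\<lambda>\<xi>. \<xi>) \<in> measurable Qo borel"
    by (simp add: measurable_cong_sets[OF sQo refl] measurable_restrict_space1)
  have id2: "(\<lambda>r. r) \<in> measurable (Qr \<xi>) borel" if "\<xi> \<in> sphere 0 1" for \<xi>
    by (simp add: measurable_cong_sets[OF sQr[OF that] refl] measurable_restrict_space1)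
  have ray: "(\<lambda>r. u (r *\<^sub>R \<xi>)) \<in> borel_measurable (Qr \<xi>)"
    if "\<xi> \<in> sphere 0 1" and [measurable]: "u \<in> borel_measurable borel" for \<xi> and u :: "real^'n \<Rightarrow> ennreal"
  proof -
    note [measurable] = id2[OF that(1)]
    show ?thesis by measurable
  qed
  \<comment> \<open>Measurability of the inner integral in \<open>\<xi>\<close> is part of the
    induction claim because additivity and monotone convergence of the outer integral depend on
    it.\<close>
  have "(\<lambda>\<xi>. \<integral>\<^sup>+r. \<Phi> (r *\<^sub>R \<xi>) \<partial>Qr \<xi>) \<in> borel_measurable Qo \<and>
    (\<integral>\<^sup>+y. \<Phi> y \<partial>Q) = (\<integral>\<^sup>+\<xi>. (\<integral>\<^sup>+r. \<Phi> (r *\<^sub>R \<xi>) \<partial>Qr \<xi>) \<partial>Qo)"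
    using \<Phi>
  proof (induction rule: borel_measurable_induct)
    case (cong f g)
    then have "f = g" by (auto simp: fun_eq_iff)
    with cong show ?case by simp
  next
    case (set B)
    note id1[measurable]
    \<comment> \<open>For an indicator the inner integral is the mass of a section of the preimage
      of \<open>B\<close> under this map, so its measurability is the preceding lemma.\<close>
    have "(\<lambda>p. snd p *\<^sub>R fst p) \<in> measurable (Qo \<Otimes>\<^sub>M (borel :: real measure)) (borel :: (real^'n) measure)"
      by measurable
    from measurable_sets[OF this set]
    have "(\<lambda>p. snd p *\<^sub>R fst p) -` B \<inter> space (Qo \<Otimes>\<^sub>M borel) \<in> sets (Qo \<Otimes>\<^sub>M (borel :: real measure))" .
    from polar_decomposition_measurable[OF pd fin this]
    have "(\<lambda>\<xi>. emeasure (Qr \<xi>) {r. 0 < r \<and> (\<xi>, r) \<in> (\<lambda>p. snd p *\<^sub>R fst p) -` B \<inter> space (Qo \<Otimes>\<^sub>M borel)}) \<in> borel_measurable Qo"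
      by simp
    also have "?this \<longleftrightarrow> (\<lambda>\<xi>. \<integral>\<^sup>+r. indicator B (r *\<^sub>R \<xi>) \<partial>Qr \<xi>) \<in> borel_measurable Qo"
    proof (rule measurable_cong)
      fix \<xi> assume \<xi>: "\<xi> \<in> space Qo"
      then have \<xi>': "\<xi> \<in> sphere 0 1" by (simp add: spQo)
      have spr: "space (Qr \<xi>) = {0<..}"
        using sets_eq_imp_space_eq[OF sQr[OF \<xi>']] by (simp add: space_restrict_space)
      have "{r. 0 < r \<and> (\<xi>, r) \<in> (\<lambda>p. snd p *\<^sub>R fst p) -` B \<inter> space (Qo \<Otimes>\<^sub>M borel)} = {r \<in> space (Qr \<xi>). r *\<^sub>R \<xi> \<in> B}"
        using \<xi> by (auto simp: spr space_pair_measure)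
      moreover have "(\<integral>\<^sup>+r. indicator B (r *\<^sub>R \<xi>) \<partial>Qr \<xi>) = emeasure (Qr \<xi>) {r \<in> space (Qr \<xi>). r *\<^sub>R \<xi> \<in> B}"
      proof -
        note [measurable] = id2[OF \<xi>'] set
        have "(\<integral>\<^sup>+r. indicator B (r *\<^sub>R \<xi>) \<partial>Qr \<xi>) = (\<integral>\<^sup>+r. indicator {r \<in> space (Qr \<xi>). r *\<^sub>R \<xi> \<in> B} r \<partial>Qr \<xi>)"
          by (intro nn_integral_cong) (auto simp: indicator_def)
        also have "\<dots> = emeasure (Qr \<xi>) {r \<in> space (Qr \<xi>). r *\<^sub>R \<xi> \<in> B}"
          by (rule nn_integral_indicator) measurable
        finally show ?thesis .
      qed
      ultimately show "emeasure (Qr \<xi>) {r. 0 < r \<and> (\<xi>, r) \<in> (\<lambda>p. snd p *\<^sub>R fst p) -` B \<inter> space (Qo \<Otimes>\<^sub>M borel)} =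
          (\<integral>\<^sup>+r. indicator B (r *\<^sub>R \<xi>) \<partial>Qr \<xi>)" by simp
    qed
    finally have m: "(\<lambda>\<xi>. \<integral>\<^sup>+r. indicator B (r *\<^sub>R \<xi>) \<partial>Qr \<xi>) \<in> borel_measurable Qo" .
    with set eQ[OF set] sQ show ?case by simp
  next
    case (mult u c)
    have "(\<integral>\<^sup>+r. c * u (r *\<^sub>R \<xi>) \<partial>Qr \<xi>) = c * (\<integral>\<^sup>+r. u (r *\<^sub>R \<xi>) \<partial>Qr \<xi>)" if "\<xi> \<in> space Qo" for \<xi>
      using that mult by (intro nn_integral_cmult ray) (auto simp: spQo)
    then show ?case using mult
      by (auto simp: nn_integral_cmult borel_measurable_times_ennreal cong: nn_integral_cong measurable_cong)
  next
    case (add u v)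
    have "(\<integral>\<^sup>+r. v (r *\<^sub>R \<xi>) + u (r *\<^sub>R \<xi>) \<partial>Qr \<xi>) = (\<integral>\<^sup>+r. v (r *\<^sub>R \<xi>) \<partial>Qr \<xi>) + (\<integral>\<^sup>+r. u (r *\<^sub>R \<xi>) \<partial>Qr \<xi>)"
      if "\<xi> \<in> space Qo" for \<xi>
      using that add by (intro nn_integral_add ray) (auto simp: spQo)
    then show ?case using add
      by (auto simp: nn_integral_add borel_measurable_add cong: nn_integral_cong measurable_cong)
  next
    case (seq U)
    have eq: "(\<integral>\<^sup>+r. (SUP i. U i) (r *\<^sub>R \<xi>) \<partial>Qr \<xi>) = (SUP i. \<integral>\<^sup>+r. U i (r *\<^sub>R \<xi>) \<partial>Qr \<xi>)" if "\<xi> \<in> space Qo" for \<xi>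
      unfolding SUP_apply using that seq
      by (intro nn_integral_monotone_convergence_SUP ray) (auto simp: spQo incseq_def le_fun_def)
    have inc: "incseq (\<lambda>i \<xi>. \<integral>\<^sup>+r. U i (r *\<^sub>R \<xi>) \<partial>Qr \<xi>)"
      using seq(3) by (auto simp: incseq_def le_fun_def intro!: nn_integral_mono)
    have "(\<integral>\<^sup>+y. (SUP i. U i) y \<partial>Q) = (SUP i. \<integral>\<^sup>+y. U i y \<partial>Q)"
      unfolding SUP_apply using seq by (intro nn_integral_monotone_convergence_SUP) auto
    also have "\<dots> = (SUP i. \<integral>\<^sup>+\<xi>. (\<integral>\<^sup>+r. U i (r *\<^sub>R \<xi>) \<partial>Qr \<xi>) \<partial>Qo)"
      using seq by simp
    also have "\<dots> = (\<integral>\<^sup>+\<xi>. (SUP i. \<integral>\<^sup>+r. U i (r *\<^sub>R \<xi>) \<partial>Qr \<xi>) \<partial>Qo)"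
      using seq inc by (intro nn_integral_monotone_convergence_SUP[symmetric]) auto
    moreover have "(\<lambda>\<xi>. SUP i. \<integral>\<^sup>+r. U i (r *\<^sub>R \<xi>) \<partial>Qr \<xi>) \<in> borel_measurable Qo"
      using seq by (intro borel_measurable_SUP) auto
    ultimately show ?case using eq
      by (simp cong: nn_integral_cong measurable_cong)
  qed
  then show ?thesis by blast
qed

subsection \<open>Radial tails\<close>

text \<open>Description of the tails that does not mention a polar decomposition: \<open>j = 0\<close> gives the
  integrated radial tail, \<open>j = 1\<close> the double-integrated one.\<close>

definition radial_image :: "nat \<Rightarrow> (real^'n::finite) measure \<Rightarrow> (real^'n) measure" where
  "radial_image j Q = distr
     (density (Q \<Otimes>\<^sub>M lborel) (\<lambda>(y, z). ennreal (indicator {0<..<norm y} z * (norm y - z) ^ j)))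
     borel (\<lambda>(y, z). z *\<^sub>R (y /\<^sub>R norm y))"

lemma radial_weight_measurable [measurable]:
  "(\<lambda>(r, z). indicator {0<..<r} z * (r - z) ^ j :: real) \<in> borel_measurable (borel \<Otimes>\<^sub>M borel)"
proof -
  have "(\<lambda>(r, z). indicator {0<..<r} z * (r - z) ^ j :: real) = (\<lambda>(r, z). if 0 < z \<and> z < r then (r - z) ^ j else 0)"
    by (auto simp: fun_eq_iff)
  also have "\<dots> \<in> borel_measurable (borel \<Otimes>\<^sub>M borel)" by measurable
  finally show ?thesis .
qed

text \<open>Change of variables for the image, then for the density, then Tonelli with the radius
  \<open>z\<close> integrated first.\<close>

lemma nn_integral_radial_image:
  fixes Q :: "(real^'n::finite) measure"
  assumes sQ [measurable_cong]: "sets Q = sets borel"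
    and [measurable]: "g \<in> borel_measurable borel"
  shows "(\<integral>\<^sup>+y. g y \<partial>radial_image j Q) =
    (\<integral>\<^sup>+y. (\<integral>\<^sup>+z. ennreal (indicator {0<..<norm y} z * (norm y - z) ^ j) * g (z *\<^sub>R (y /\<^sub>R norm y)) \<partial>lborel) \<partial>Q)"
proof -
  have [measurable]: "(\<lambda>p. indicator {0<..<norm (fst p)} (snd p) * (norm (fst p) - snd p) ^ j :: real)
      \<in> borel_measurable (Q \<Otimes>\<^sub>M lborel)"
    using measurable_compose[OF _ radial_weight_measurable[of j], of "\<lambda>p. (norm (fst p), snd p)" "Q \<Otimes>\<^sub>M lborel"]
    by simp
  show ?thesis
    unfolding radial_image_def
    by (simp add: nn_integral_distr nn_integral_density split_beta' lborel.nn_integral_fst[symmetric])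
qed

text \<open>Fubini for a signed \<open>g\<close>: \<open>fin\<close> is absolute integrability on
  the product. Besides the value of the integral, Fubini gives integrability of the inner integral
  in \<open>y\<close>. When \<open>g\<close> is a directional derivative of \<open>f\<close>, that
  inner integral is a Taylor remainder, and this is how its integrability against \<open>Q\<close>
  is obtained.\<close>

lemma
  fixes Q :: "(real^'n::finite) measure" and g :: "real^'n \<Rightarrow> real"
  assumes "sigma_finite_measure Q"
    and sQ [measurable_cong]: "sets Q = sets borel"
    and [measurable]: "g \<in> borel_measurable borel"
    and fin: "(\<integral>\<^sup>+y. (\<integral>\<^sup>+z. ennreal (indicator {0<..<norm y} z * (norm y - z) ^ j) *
                ennreal \<bar>g (z *\<^sub>R (y /\<^sub>R norm y))\<bar> \<partial>lborel) \<partial>Q) < \<infinity>"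
  shows integrable_radial_image: "integrable (radial_image j Q) g"
    and integrable_radial_integral: "integrable Q
      (\<lambda>y. LINT z|lborel. indicator {0<..<norm y} z * (norm y - z) ^ j * g (z *\<^sub>R (y /\<^sub>R norm y)))"
    and integral_radial_image: "integral\<^sup>L (radial_image j Q) g =
      (LINT y|Q. LINT z|lborel. indicator {0<..<norm y} z * (norm y - z) ^ j * g (z *\<^sub>R (y /\<^sub>R norm y)))"
proof -
  interpret sigma_finite_measure Q by fact
  interpret P: pair_sigma_finite Q lborel ..
  have w [measurable]: "(\<lambda>p. indicator {0<..<norm (fst p)} (snd p) * (norm (fst p) - snd p) ^ j :: real)
      \<in> borel_measurable (Q \<Otimes>\<^sub>M lborel)"
    using measurable_compose[OF _ radial_weight_measurable[of j], of "\<lambda>p. (norm (fst p), snd p)" "Q \<Otimes>\<^sub>M lborel"]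
    by simp
  have w0: "0 \<le> indicator {0<..<norm y} z * (norm y - z) ^ j" for y :: "real^'n" and z :: real
    by (simp add: indicator_def)
  have [measurable]: "g \<in> borel_measurable (radial_image j Q)"
    by (simp add: radial_image_def)
  show int: "integrable (radial_image j Q) g"
    using fin by (intro integrableI_bounded) (simp_all add: nn_integral_radial_image sQ)
  then have int2: "integrable (Q \<Otimes>\<^sub>M lborel)
      (\<lambda>(y, z). indicator {0<..<norm y} z * (norm y - z) ^ j * g (z *\<^sub>R (y /\<^sub>R norm y)))"
    unfolding radial_image_def by (simp add: integrable_distr_eq integrable_density split_beta' w0)
  show "integrable Q
      (\<lambda>y. LINT z|lborel. indicator {0<..<norm y} z * (norm y - z) ^ j * g (z *\<^sub>R (y /\<^sub>R norm y)))"
    using P.integrable_fst[OF int2] .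
  show "integral\<^sup>L (radial_image j Q) g =
      (LINT y|Q. LINT z|lborel. indicator {0<..<norm y} z * (norm y - z) ^ j * g (z *\<^sub>R (y /\<^sub>R norm y)))"
    unfolding P.integral_fst[OF int2]
    by (simp add: radial_image_def integral_distr integral_density split_beta' w0)
qed

text \<open>For a fixed unit vector \<open>\<xi>\<close>, Tonelli exchanges \<open>z\<close> and
  \<open>r\<close>. Since \<open>r *\<^sub>R \<xi>\<close> has norm \<open>r\<close> and direction
  \<open>\<xi>\<close>, the result depends on that point alone, and integration in polar coordinates
  turns it into an integral over \<open>Q\<close>. The two tails differ only in the exponent
  \<open>j\<close> of the inner integral over \<open>r\<close>.\<close>

lemma polar_decomposition_radial_image:
  fixes Q :: "(real^'n::finite) measure"
  assumes pd: "polar_decomposition Q Qo Qr"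
    and fin: "\<And>\<xi> e. \<xi> \<in> sphere 0 1 \<Longrightarrow> 0 < e \<Longrightarrow> emeasure (Qr \<xi>) {e<..} < \<infinity>"
    and sQ: "sets Q = sets borel"
    and B [measurable]: "B \<in> sets borel"
  shows "(\<integral>\<^sup>+\<xi>. (\<integral>\<^sup>+z\<in>{0<..}. indicator B (z *\<^sub>R \<xi>) *
       (\<integral>\<^sup>+r. ennreal (indicator {0<..<r} z * (r - z) ^ j) \<partial>Qr \<xi>) \<partial>lborel) \<partial>Qo) = emeasure (radial_image j Q) B"
proof -
  have sQo: "sets Qo = sets (restrict_space borel (sphere 0 1))"
    and sQr: "\<And>\<xi>. \<xi> \<in> sphere 0 1 \<Longrightarrow> sets (Qr \<xi>) = sets (restrict_space borel {0<..})"
    and sf: "\<And>\<xi>. \<xi> \<in> sphere 0 1 \<Longrightarrow> sigma_finite_measure (Qr \<xi>)"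
    using pd unfolding polar_decomposition_def by auto
  have spQo: "space Qo = sphere 0 1"
    using sets_eq_imp_space_eq[OF sQo] by (simp add: space_restrict_space)
  let ?\<Phi> = "\<lambda>y::real^'n. \<integral>\<^sup>+z. ennreal (indicator {0<..<norm y} z * (norm y - z) ^ j) *
      indicator B (z *\<^sub>R (y /\<^sub>R norm y)) \<partial>lborel"
  have \<Phi>: "?\<Phi> \<in> borel_measurable borel"
  proof -
    have [measurable]: "(\<lambda>p::(real^'n) \<times> real. indicator {0<..<norm (fst p)} (snd p) * (norm (fst p) - snd p) ^ j :: real)
        \<in> borel_measurable (borel \<Otimes>\<^sub>M lborel)"
      using measurable_compose[OF _ radial_weight_measurable[of j], of "\<lambda>p::(real^'n) \<times> real. (norm (fst p), snd p)" "borel \<Otimes>\<^sub>M lborel"]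
      by simp
    show ?thesis
      using lborel.borel_measurable_nn_integral_fst[of "\<lambda>p::(real^'n) \<times> real. ennreal (indicator {0<..<norm (fst p)} (snd p) * (norm (fst p) - snd p) ^ j) *
      indicator B (snd p *\<^sub>R (fst p /\<^sub>R norm (fst p)))" borel] by simp
  qed
  have inner: "(\<integral>\<^sup>+z\<in>{0<..}. indicator B (z *\<^sub>R \<xi>) *
       (\<integral>\<^sup>+r. ennreal (indicator {0<..<r} z * (r - z) ^ j) \<partial>Qr \<xi>) \<partial>lborel) = (\<integral>\<^sup>+r. ?\<Phi> (r *\<^sub>R \<xi>) \<partial>Qr \<xi>)"
    if \<xi>: "\<xi> \<in> space Qo" for \<xi>
  proof -
    have \<xi>': "\<xi> \<in> sphere 0 1" "norm \<xi> = 1" using \<xi> by (auto simp: spQo)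
    interpret R: sigma_finite_measure "Qr \<xi>" by (rule sf) fact
    interpret P: pair_sigma_finite "Qr \<xi>" lborel ..
    have id [measurable]: "(\<lambda>r. r) \<in> measurable (Qr \<xi>) borel"
      by (simp add: measurable_cong_sets[OF sQr[OF \<xi>'(1)] refl] measurable_restrict_space1)
    have spr: "space (Qr \<xi>) = {0<..}"
      using sets_eq_imp_space_eq[OF sQr[OF \<xi>'(1)]] by (simp add: space_restrict_space)
    have [measurable]: "(\<lambda>p. indicator {0<..<fst p} (snd p) * (fst p - snd p) ^ j :: real)
        \<in> borel_measurable (Qr \<xi> \<Otimes>\<^sub>M lborel)"
      using measurable_compose[OF _ radial_weight_measurable[of j], of "\<lambda>p. (fst p, snd p)" "Qr \<xi> \<Otimes>\<^sub>M lborel"]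
      by (simp add: split_beta')
    have [measurable]: "(\<lambda>r. indicator {0<..<r} z * (r - z) ^ j :: real) \<in> borel_measurable (Qr \<xi>)" for z
      using measurable_compose[OF _ radial_weight_measurable[of j], of "\<lambda>r. (r, z)" "Qr \<xi>"]
      by simp
    have "(\<integral>\<^sup>+z\<in>{0<..}. indicator B (z *\<^sub>R \<xi>) *
       (\<integral>\<^sup>+r. ennreal (indicator {0<..<r} z * (r - z) ^ j) \<partial>Qr \<xi>) \<partial>lborel)
      = (\<integral>\<^sup>+z. (\<integral>\<^sup>+r. ennreal (indicator {0<..<r} z * (r - z) ^ j) * indicator B (z *\<^sub>R \<xi>) \<partial>Qr \<xi>) \<partial>lborel)"
      by (intro nn_integral_cong) (auto simp: nn_integral_multc indicator_def)
    also have "\<dots> = (\<integral>\<^sup>+r. (\<integral>\<^sup>+z. ennreal (indicator {0<..<r} z * (r - z) ^ j) * indicator B (z *\<^sub>R \<xi>) \<partial>lborel) \<partial>Qr \<xi>)"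
      by (intro P.Fubini') (simp add: split_beta')
    also have "\<dots> = (\<integral>\<^sup>+r. ?\<Phi> (r *\<^sub>R \<xi>) \<partial>Qr \<xi>)"
      by (intro nn_integral_cong) (simp add: spr \<xi>')
    finally show ?thesis .
  qed
  have "(\<integral>\<^sup>+\<xi>. (\<integral>\<^sup>+z\<in>{0<..}. indicator B (z *\<^sub>R \<xi>) *
       (\<integral>\<^sup>+r. ennreal (indicator {0<..<r} z * (r - z) ^ j) \<partial>Qr \<xi>) \<partial>lborel) \<partial>Qo)
     = (\<integral>\<^sup>+\<xi>. (\<integral>\<^sup>+r. ?\<Phi> (r *\<^sub>R \<xi>) \<partial>Qr \<xi>) \<partial>Qo)"
    by (rule nn_integral_cong) (rule inner)
  also have "\<dots> = (\<integral>\<^sup>+y. ?\<Phi> y \<partial>Q)"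
    by (rule polar_decomposition_nn_integral[OF pd fin sQ \<Phi>, symmetric])
  also have "\<dots> = (\<integral>\<^sup>+y. indicator B y \<partial>radial_image j Q)"
    by (rule nn_integral_radial_image[symmetric, OF sQ]) simp
  also have "\<dots> = emeasure (radial_image j Q) B"
    by (simp add: radial_image_def)
  finally show ?thesis .
qed

text \<open>\<open>measure_of\<close> takes the values of \<open>m\<close> only if \<open>m\<close>
  is countably additive; agreement with a measure \<open>M\<close> on the Borel sets replaces a
  direct proof of that.\<close>

lemma measure_of_borel_eqI:
  assumes "sets M = sets borel" and "\<And>B. B \<in> sets borel \<Longrightarrow> m B = emeasure M B"
  shows "measure_of UNIV (sets borel) m = M"
proof -
  have sp: "space M = UNIV" using sets_eq_imp_space_eq[OF assms(1)] by simp
  have "measure_of UNIV (sets borel) m = measure_of UNIV (sets borel) (emeasure M)"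
    using assms(2) sets.sigma_sets_eq[of "borel :: 'a measure"] by (intro measure_of_eq) auto
  also have "\<dots> = M" using measure_of_of_measure[of M] by (simp add: sp assms(1))
  finally show ?thesis .
qed

text \<open>For \<open>z > 0\<close> the mass of \<open>{z<..}\<close> is the integral over
  \<open>r\<close> of the weight with \<open>j = 0\<close>, the indicator of
  \<open>z < r\<close>.\<close>

lemma radial_tail_measure_eq:
  fixes Q :: "(real^'n::finite) measure"
  assumes pd: "polar_decomposition Q Qo Qr"
    and fin: "\<And>\<xi> e. \<xi> \<in> sphere 0 1 \<Longrightarrow> 0 < e \<Longrightarrow> emeasure (Qr \<xi>) {e<..} < \<infinity>"
    and sQ: "sets Q = sets borel"
  shows "radial_tail_measure Qo Qr = radial_image 0 Q"
  unfolding radial_tail_measure_def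
proof (rule measure_of_borel_eqI)
  fix B :: "(real^'n) set" assume B: "B \<in> sets borel"
  have sQo: "sets Qo = sets (restrict_space borel (sphere 0 1))"
    and sQr: "\<And>\<xi>. \<xi> \<in> sphere 0 1 \<Longrightarrow> sets (Qr \<xi>) = sets (restrict_space borel {0<..})"
    using pd unfolding polar_decomposition_def by auto
  have spQo: "space Qo = sphere 0 1"
    using sets_eq_imp_space_eq[OF sQo] by (simp add: space_restrict_space)
  have tail: "emeasure (Qr \<xi>) {z<..} = (\<integral>\<^sup>+r. ennreal (indicator {0<..<r} z * (r - z) ^ 0) \<partial>Qr \<xi>)"
    if "\<xi> \<in> space Qo" "0 < z" for \<xi> and z :: real
  proof -
    have "{z<..} \<in> sets (Qr \<xi>)"
      using that by (auto simp: sQr spQo sets_restrict_space image_iff intro!: bexI[of _ "{z<..}"])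
    then have "emeasure (Qr \<xi>) {z<..} = (\<integral>\<^sup>+r. indicator {z<..} r \<partial>Qr \<xi>)" by simp
    also have "\<dots> = (\<integral>\<^sup>+r. ennreal (indicator {0<..<r} z * (r - z) ^ 0) \<partial>Qr \<xi>)"
      using that by (intro nn_integral_cong) (auto simp: indicator_def)
    finally show ?thesis .
  qed
  show "(\<integral>\<^sup>+\<xi>. (\<integral>\<^sup>+z\<in>{0<..}. indicator B (z *\<^sub>R \<xi>) * emeasure (Qr \<xi>) {z<..} \<partial>lborel) \<partial>Qo)
      = emeasure (radial_image 0 Q) B"
    by (subst polar_decomposition_radial_image[where j = 0, OF pd fin sQ B, symmetric], assumption, assumption,
        intro nn_integral_cong) (auto simp: tail indicator_def)
qed (simp add: radial_image_def)

text \<open>Layer-cake formula: integrating the mass of \<open>{z\<^sub>1<..}\<close> over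
  \<open>z\<^sub>1 > z\<close> gives the integral of the positive part of \<open>r - z\<close>,
  which is the weight with \<open>j = 1\<close>.\<close>

lemma double_radial_tail_measure_eq:
  fixes Q :: "(real^'n::finite) measure"
  assumes pd: "polar_decomposition Q Qo Qr"
    and fin: "\<And>\<xi> e. \<xi> \<in> sphere 0 1 \<Longrightarrow> 0 < e \<Longrightarrow> emeasure (Qr \<xi>) {e<..} < \<infinity>"
    and sQ: "sets Q = sets borel"
  shows "double_radial_tail_measure Qo Qr = radial_image 1 Q"
  unfolding double_radial_tail_measure_def
proof (rule measure_of_borel_eqI)
  fix B :: "(real^'n) set" assume B: "B \<in> sets borel"
  have sQo: "sets Qo = sets (restrict_space borel (sphere 0 1))"
    and sQr: "\<And>\<xi>. \<xi> \<in> sphere 0 1 \<Longrightarrow> sets (Qr \<xi>) = sets (restrict_space borel {0<..})"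
    and sf: "\<And>\<xi>. \<xi> \<in> sphere 0 1 \<Longrightarrow> sigma_finite_measure (Qr \<xi>)"
    using pd unfolding polar_decomposition_def by auto
  have spQo: "space Qo = sphere 0 1"
    using sets_eq_imp_space_eq[OF sQo] by (simp add: space_restrict_space)
  have tail: "(\<integral>\<^sup>+z\<^sub>1\<in>{z<..}. emeasure (Qr \<xi>) {z\<^sub>1<..} \<partial>lborel) =
      (\<integral>\<^sup>+r. ennreal (indicator {0<..<r} z * (r - z) ^ 1) \<partial>Qr \<xi>)"
    if \<xi>: "\<xi> \<in> space Qo" and z: "0 < z" for \<xi> and z :: real
  proof -
    have \<xi>': "\<xi> \<in> sphere 0 1" using \<xi> by (auto simp: spQo)
    interpret R: sigma_finite_measure "Qr \<xi>" by (rule sf) fact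
    interpret P: pair_sigma_finite "Qr \<xi>" lborel ..
    have id [measurable]: "(\<lambda>r. r) \<in> measurable (Qr \<xi>) borel"
      by (simp add: measurable_cong_sets[OF sQr[OF \<xi>'] refl] measurable_restrict_space1)
    have half: "{t<..} \<in> sets (Qr \<xi>)" if "0 < t" for t
      using that by (auto simp: sQr[OF \<xi>'] sets_restrict_space image_iff intro!: bexI[of _ "{t<..}"])
    \<comment> \<open>Both constraints, \<open>z < z\<^sub>1\<close> from the domain and
      \<open>z\<^sub>1 < r\<close> from the tail, go into a single integrand on the product so that
      Tonelli applies.\<close>
    have "(\<integral>\<^sup>+z\<^sub>1\<in>{z<..}. emeasure (Qr \<xi>) {z\<^sub>1<..} \<partial>lborel) =
        (\<integral>\<^sup>+z\<^sub>1. (\<integral>\<^sup>+r. (if z < z\<^sub>1 \<and> z\<^sub>1 < r then 1 else 0) \<partial>Qr \<xi>) \<partial>lborel)"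
    proof (rule nn_integral_cong)
      fix t :: real
      show "emeasure (Qr \<xi>) {t<..} * indicator {z<..} t = (\<integral>\<^sup>+r. (if z < t \<and> t < r then 1 else 0) \<partial>Qr \<xi>)"
      proof (cases "z < t")
        case True
        then have "emeasure (Qr \<xi>) {t<..} = (\<integral>\<^sup>+r. indicator {t<..} r \<partial>Qr \<xi>)" using half z by simp
        also have "\<dots> = (\<integral>\<^sup>+r. (if z < t \<and> t < r then 1 else 0) \<partial>Qr \<xi>)"
          using True by (intro nn_integral_cong) (auto simp: indicator_def)
        finally show ?thesis using True by simp
      qed simp
    qed
    also have "\<dots> = (\<integral>\<^sup>+r. (\<integral>\<^sup>+z\<^sub>1. (if z < z\<^sub>1 \<and> z\<^sub>1 < r then 1 else 0) \<partial>lborel) \<partial>Qr \<xi>)"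
      by (intro P.Fubini') (simp add: split_beta')
    also have "\<dots> = (\<integral>\<^sup>+r. ennreal (indicator {0<..<r} z * (r - z) ^ 1) \<partial>Qr \<xi>)"
    proof (rule nn_integral_cong)
      fix r :: real
      have "(\<integral>\<^sup>+z\<^sub>1. (if z < z\<^sub>1 \<and> z\<^sub>1 < r then 1 else 0) \<partial>lborel) = (\<integral>\<^sup>+z\<^sub>1. indicator {z<..<r} z\<^sub>1 \<partial>lborel)"
        by (intro nn_integral_cong) (auto simp: indicator_def)
      also have "\<dots> = emeasure lborel {z<..<r}" by simp
      also have "\<dots> = ennreal (indicator {0<..<r} z * (r - z) ^ 1)"
        using z by (cases "z < r") auto
      finally show "(\<integral>\<^sup>+z\<^sub>1. (if z < z\<^sub>1 \<and> z\<^sub>1 < r then 1 else 0) \<partial>lborel) = ennreal (indicator {0<..<r} z * (r - z) ^ 1)" .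
    qed
    finally show ?thesis .
  qed
  show "(\<integral>\<^sup>+\<xi>. (\<integral>\<^sup>+z\<^sub>2\<in>{0<..}. indicator B (z\<^sub>2 *\<^sub>R \<xi>) *
                  (\<integral>\<^sup>+z\<^sub>1\<in>{z\<^sub>2<..}. emeasure (Qr \<xi>) {z\<^sub>1<..} \<partial>lborel) \<partial>lborel) \<partial>Qo)
      = emeasure (radial_image 1 Q) B"
    by (subst polar_decomposition_radial_image[where j = 1, OF pd fin sQ B, symmetric], assumption, assumption,
        intro nn_integral_cong) (use tail in \<open>auto simp: indicator_def\<close>)
qed (simp add: radial_image_def)

text \<open>A Chebyshev bound that turns the moment conditions on the radial parts into finite mass
  away from \<open>0\<close>, as integration in polar coordinates requires.\<close>

lemma radial_tail_finite:
  fixes \<psi> :: "real \<Rightarrow> real"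
  assumes sM: "sets M = sets (restrict_space borel {0<..})"
    and fin: "(\<integral>\<^sup>+r. ennreal (\<psi> r) \<partial>M) < \<infinity>"
    and c: "0 < c" and le: "\<And>r. e < r \<Longrightarrow> c \<le> \<psi> r" and e: "0 < e"
  shows "emeasure M {e<..} < \<infinity>"
proof -
  have "{e<..} \<in> sets M"
    using e by (auto simp: sM sets_restrict_space image_iff intro!: bexI[of _ "{e<..}"])
  then have "ennreal c * emeasure M {e<..} = (\<integral>\<^sup>+r. ennreal c * indicator {e<..} r \<partial>M)"
    by (simp add: nn_integral_cmult_indicator)
  also have "\<dots> \<le> (\<integral>\<^sup>+r. ennreal (\<psi> r) \<partial>M)"
    using le by (intro nn_integral_mono) (auto simp: indicator_def intro!: ennreal_leI)
  also note fin
  finally show ?thesis using c by (auto simp: ennreal_mult_less_top)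
qed

text \<open>The right-hand side names no polar decomposition, so this contains the independence of
  the choice. The radial Levy condition enters through
  \<open>min 1 (r\<^sup>2) \<ge> min 1 (e\<^sup>2)\<close> for \<open>r > e\<close>.\<close>

lemma integrated_radial_tail_eq:
  fixes Q :: "real^'n::finite \<Rightarrow> (real^'n) measure"
  assumes "integrated_radial_tail Q T" and "sets (Q x) = sets borel"
  shows "T x = radial_image 0 (Q x)"
proof -
  obtain Qo Qr where pd: "polar_decomposition (Q x) Qo Qr"
    and fin: "\<And>\<xi>. \<xi> \<in> sphere 0 1 \<Longrightarrow> (\<integral>\<^sup>+r. ennreal (min 1 (r\<^sup>2)) \<partial>Qr \<xi>) < \<infinity>"
    and T: "T x = radial_tail_measure Qo Qr"
    using assms(1) unfolding integrated_radial_tail_def by meson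
  have sQr: "\<And>\<xi>. \<xi> \<in> sphere 0 1 \<Longrightarrow> sets (Qr \<xi>) = sets (restrict_space borel {0<..})"
    using pd unfolding polar_decomposition_def by auto
  show ?thesis
    unfolding T
  proof (rule radial_tail_measure_eq[OF pd _ assms(2)])
    fix \<xi> :: "real^'n" and e :: real assume \<xi>: "\<xi> \<in> sphere 0 1" and e: "0 < e"
    show "emeasure (Qr \<xi>) {e<..} < \<infinity>"
      by (rule radial_tail_finite[OF sQr[OF \<xi>] fin[OF \<xi>], of "min 1 (e\<^sup>2)"])
        (use e in \<open>auto simp: min_le_iff_disj intro!: power_mono\<close>)
  qed
qed

lemma double_integrated_radial_tail_eq:
  fixes Q :: "real^'n::finite \<Rightarrow> (real^'n) measure"
  assumes "double_integrated_radial_tail Q T" and "sets (Q x) = sets borel"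
  shows "T x = radial_image 1 (Q x)"
proof -
  obtain Qo Qr where pd: "polar_decomposition (Q x) Qo Qr"
    and fin: "\<And>\<xi>. \<xi> \<in> sphere 0 1 \<Longrightarrow> (\<integral>\<^sup>+r. ennreal (min r (r\<^sup>2)) \<partial>Qr \<xi>) < \<infinity>"
    and T: "T x = double_radial_tail_measure Qo Qr"
    using assms(1) unfolding double_integrated_radial_tail_def by meson
  have sQr: "\<And>\<xi>. \<xi> \<in> sphere 0 1 \<Longrightarrow> sets (Qr \<xi>) = sets (restrict_space borel {0<..})"
    using pd unfolding polar_decomposition_def by auto
  show ?thesis
    unfolding T
  proof (rule double_radial_tail_measure_eq[OF pd _ assms(2)])
    fix \<xi> :: "real^'n" and e :: real assume \<xi>: "\<xi> \<in> sphere 0 1" and e: "0 < e"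
    show "emeasure (Qr \<xi>) {e<..} < \<infinity>"
      by (rule radial_tail_finite[OF sQr[OF \<xi>] fin[OF \<xi>], of "min e (e\<^sup>2)"])
        (use e in \<open>auto simp: min_le_iff_disj intro!: power_mono\<close>)
  qed
qed

subsection \<open>Taylor remainders as tail integrals\<close>

lemma has_real_derivative_along_line:
  fixes f :: "'a::real_normed_vector \<Rightarrow> real"
  assumes "(f has_derivative f') (at (x + z *\<^sub>R \<xi>))"
  shows "((\<lambda>z. f (x + z *\<^sub>R \<xi>)) has_real_derivative f' \<xi>) (at z)"
proof -
  interpret f': bounded_linear f' using assms by (rule has_derivative_bounded_linear)
  have "((\<lambda>z. f (x + z *\<^sub>R \<xi>)) has_derivative (\<lambda>t. f' (t *\<^sub>R \<xi>))) (at z)"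
    by (rule has_derivative_compose[where f = "\<lambda>z. x + z *\<^sub>R \<xi>" and g = f, OF _ assms])
      (auto intro!: derivative_eq_intros)
  then show ?thesis
    by (rule has_derivative_imp_has_field_derivative) (simp add: f'.scaleR)
qed

text \<open>Link between the coordinatewise \<open>grad\<close> and the Frechet derivative: each
  partial derivative is \<open>f'\<close> at a basis vector, and linearity reassembles
  \<open>\<xi>\<close>.\<close>

lemma dir_deriv_eq:
  assumes "(f has_derivative f') (at z)"
  shows "dir_deriv \<xi> f z = f' \<xi>"
proof -
  interpret f': bounded_linear f' using assms by (rule has_derivative_bounded_linear)
  have p: "partial i f z = f' (axis i 1)" for i
    unfolding partial_def
    by (rule DERIV_imp_deriv) (use has_real_derivative_along_line[of f f' z 0] assms in simp)
  have "dir_deriv \<xi> f z = (\<Sum>i\<in>UNIV. \<xi> $ i * f' (axis i 1))"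
    by (simp add: dir_deriv_def grad_def inner_vec_def p)
  also have "\<dots> = f' (\<Sum>i\<in>UNIV. \<xi> $ i *\<^sub>R axis i 1)"
    by (simp add: f'.sum f'.scaleR)
  also have "(\<Sum>i\<in>UNIV. \<xi> $ i *\<^sub>R axis i 1) = \<xi>"
    using basis_expansion[of \<xi>] by (simp add: scalar_mult_eq_scaleR)
  finally show ?thesis .
qed

text \<open>Both derivatives vanish off the closed support of \<open>f\<close>, and a continuous
  function that vanishes off a compact set is bounded. A single \<open>C\<close> and a single
  \<open>R\<close> serve all orders.\<close>

lemma C2c_E:
  fixes f :: "real^'n::finite \<Rightarrow> real"
  assumes "f \<in> C2c"
  obtains f' :: "real^'n \<Rightarrow> (real^'n) \<Rightarrow>\<^sub>L real" and f'' :: "real^'n \<Rightarrow> (real^'n) \<Rightarrow>\<^sub>L ((real^'n) \<Rightarrow>\<^sub>L real)"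
    and C R :: real
  where "\<And>z. (f has_derivative f' z) (at z)" "\<And>z. (f' has_derivative f'' z) (at z)"
    "continuous_on UNIV f'" "continuous_on UNIV f''"
    "\<And>z. \<bar>f z\<bar> \<le> C" "\<And>z. norm (f' z) \<le> C" "\<And>z. norm (f'' z) \<le> C"
    "\<And>z. R < norm z \<Longrightarrow> f' z = 0" "\<And>z. R < norm z \<Longrightarrow> f'' z = 0"
proof -
  obtain f' :: "real^'n \<Rightarrow> (real^'n) \<Rightarrow>\<^sub>L real" and f'' :: "real^'n \<Rightarrow> (real^'n) \<Rightarrow>\<^sub>L ((real^'n) \<Rightarrow>\<^sub>L real)"
    where d1: "\<And>z. (f has_derivative f' z) (at z)" and d2: "\<And>z. (f' has_derivative f'' z) (at z)"
      and c2: "continuous_on UNIV f''" and comp: "compact (closure {x. f x \<noteq> 0})"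
    using assms unfolding C2c_def by blast
  have c0: "continuous_on UNIV f"
    by (rule has_derivative_continuous_on) (rule has_derivative_at_withinI[OF d1])
  have c1: "continuous_on UNIV f'"
    by (rule has_derivative_continuous_on) (rule has_derivative_at_withinI[OF d2])
  let ?S = "closure {x. f x \<noteq> 0}"
  have op: "open (- ?S)" by (intro open_Compl closed_closure)
  have z0: "f z = 0" if "z \<notin> ?S" for z
    using that closure_subset[of "{x. f x \<noteq> 0}"] by blast
  have z1: "f' z = 0" if "z \<notin> ?S" for z
  proof -
    \<comment> \<open>Off the closed support, \<open>f\<close> is zero on a whole neighbourhood of
      \<open>z\<close>, so the zero function has the same derivative there.\<close>
    have "((\<lambda>_. 0) has_derivative f' z) (at z)"
      by (rule has_derivative_transform_within_open[OF d1 op]) (use that z0 in blast)+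
    then have "blinfun_apply (f' z) = (\<lambda>_. 0)"
      by (rule has_derivative_unique) (rule has_derivative_const)
    then show ?thesis by (intro blinfun_eqI) simp
  qed
  have z2: "f'' z = 0" if "z \<notin> ?S" for z
  proof -
    have "((\<lambda>_. 0) has_derivative f'' z) (at z)"
      by (rule has_derivative_transform_within_open[OF d2 op]) (use that z1 in blast)+
    then have "blinfun_apply (f'' z) = (\<lambda>_. 0)"
      by (rule has_derivative_unique) (rule has_derivative_const)
    then show ?thesis by (intro blinfun_eqI) simp
  qed
  obtain R where R: "\<And>z. z \<in> ?S \<Longrightarrow> norm z \<le> R"
    using compact_imp_bounded[OF comp] unfolding bounded_iff by blast
  have bnd: "\<exists>C. \<forall>z. norm (g z) \<le> C"
    if "continuous_on UNIV g" "\<And>z. z \<notin> ?S \<Longrightarrow> g z = 0" for g :: "real^'n \<Rightarrow> 'b::real_normed_vector"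
  proof -
    have "compact (g ` ?S)"
      using comp that(1) by (intro compact_continuous_image) (auto intro: continuous_on_subset)
    then have "bounded (g ` ?S)" by (rule compact_imp_bounded)
    then obtain B where B: "\<And>z. z \<in> ?S \<Longrightarrow> norm (g z) \<le> B"
      unfolding bounded_iff by blast
    have "norm (g z) \<le> max B 0" for z
      using B[of z] that(2)[of z] by (cases "z \<in> ?S") auto
    then show ?thesis by blast
  qed
  obtain C0 C1 C2 where C: "\<And>z. norm (f z) \<le> C0" "\<And>z. norm (f' z) \<le> C1" "\<And>z. norm (f'' z) \<le> C2"
    using bnd[OF c0 z0] bnd[OF c1 z1] bnd[OF c2 z2] by metis
  show thesis
  proof (rule that[OF d1 d2 c1 c2])
    show "\<bar>f z\<bar> \<le> max C0 (max C1 C2)" "norm (f' z) \<le> max C0 (max C1 C2)" "norm (f'' z) \<le> max C0 (max C1 C2)" for z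
      using C[of z] by (auto simp: le_max_iff_disj)
    show "f' z = 0" "f'' z = 0" if "R < norm z" for z
      using that by (intro z1 z2; use R in force)+
  qed
qed

text \<open>The fundamental theorem of calculus with the open interval of the radial weight; the
  closed interval differs by two null points.\<close>

lemma integral_FTC_open:
  fixes F G :: "real \<Rightarrow> real"
  assumes "0 \<le> r" and "\<And>z. (F has_real_derivative G z) (at z)" and "continuous_on UNIV G"
  shows "(LINT z|lborel. indicator {0<..<r} z * G z) = F r - F 0"
proof -
  have [measurable]: "G \<in> borel_measurable borel"
    using assms(3) by (rule borel_measurable_continuous_onI)
  have "(LINT z|lborel. indicator {0<..<r} z * G z) = (LINT z|lborel. G z * indicator {0..r} z)"
  proof (rule integral_cong_AE)
    show "AE z in lborel. indicator {0<..<r} z * G z = G z * indicator {0..r} z"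
      using AE_lborel_singleton[of 0] AE_lborel_singleton[of r]
      by eventually_elim (auto simp: indicator_def)
  qed simp_all
  also have "\<dots> = F r - F 0"
    using assms by (intro integral_FTC_Icc_real) (auto simp: continuous_on_eq_continuous_at)
  finally show ?thesis .
qed

text \<open>The bounded support of \<open>g\<close> cuts \<open>z\<close> off at a fixed radius, so
  the inner integral is at most a constant times \<open>norm y ^ j * min 1 (norm y)\<close>. For
  \<open>j = 0\<close> and \<open>j = 1\<close> these are the moments that a convenient
  decomposition makes finite for \<open>\<mu>\<close> and \<open>\<rho>\<close>.\<close>

lemma radial_integrand_finite:
  fixes Q :: "(real^'n::finite) measure" and g :: "real^'n \<Rightarrow> real"
  assumes sQ [measurable_cong]: "sets Q = sets borel"
    and fin: "(\<integral>\<^sup>+y. ennreal (norm y ^ j * min 1 (norm y)) \<partial>Q) < \<infinity>"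
    and bound: "\<And>y. \<bar>g y\<bar> \<le> C" and supp: "\<And>y. R < norm y \<Longrightarrow> g y = 0"
  shows "(\<integral>\<^sup>+y. (\<integral>\<^sup>+z. ennreal (indicator {0<..<norm y} z * (norm y - z) ^ j) *
                ennreal \<bar>g (z *\<^sub>R (y /\<^sub>R norm y))\<bar> \<partial>lborel) \<partial>Q) < \<infinity>"
proof -
  have C: "0 \<le> C" using bound[of 0] by linarith
  \<comment> \<open>A radius of at least \<open>1\<close> yields
    \<open>min (norm y) R' \<le> R' * min 1 (norm y)\<close> at the end.\<close>
  define R' where "R' = max 1 R"
  have R': "1 \<le> R'" "R \<le> R'" by (auto simp: R'_def)
  have "(\<integral>\<^sup>+z. ennreal (indicator {0<..<norm y} z * (norm y - z) ^ j) *
          ennreal \<bar>g (z *\<^sub>R (y /\<^sub>R norm y))\<bar> \<partial>lborel) \<le> ennreal (C * R') * ennreal (norm y ^ j * min 1 (norm y))"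
    (is "?I \<le> _") for y :: "real^'n"
  proof -
    have "?I \<le> (\<integral>\<^sup>+z. ennreal (norm y ^ j * C) * indicator {0..min (norm y) R'} z \<partial>lborel)"
    proof (rule nn_integral_mono)
      fix z :: real
      show "ennreal (indicator {0<..<norm y} z * (norm y - z) ^ j) * ennreal \<bar>g (z *\<^sub>R (y /\<^sub>R norm y))\<bar>
          \<le> ennreal (norm y ^ j * C) * indicator {0..min (norm y) R'} z"
      proof (cases "0 < z \<and> z < norm y")
        case z: True
        then have n: "norm (z *\<^sub>R (y /\<^sub>R norm y)) = z" by (cases "y = 0") auto
        show ?thesis
        proof (cases "z \<le> R'")
          case True
          have "(norm y - z) ^ j * \<bar>g (z *\<^sub>R (y /\<^sub>R norm y))\<bar> \<le> norm y ^ j * C"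
            using z bound C by (intro mult_mono power_mono) auto
          then show ?thesis using z True by (simp add: ennreal_mult'[symmetric] ennreal_leI)
        next
          case False
          then have "g (z *\<^sub>R (y /\<^sub>R norm y)) = 0" using R' n by (intro supp) linarith
          then show ?thesis by simp
        qed
      qed auto
    qed
    also have "\<dots> = ennreal (norm y ^ j * C) * ennreal (min (norm y) R')"
      using R' by (simp add: nn_integral_cmult_indicator)
    also have "\<dots> = ennreal (norm y ^ j * C * min (norm y) R')"
      using C R' by (simp add: ennreal_mult')
    also have "\<dots> \<le> ennreal (C * R' * (norm y ^ j * min 1 (norm y)))"
    proof (rule ennreal_leI)
      have "min (norm y) R' \<le> R' * min 1 (norm y)"
        using R' mult_right_mono[of 1 R' "norm y"] by (auto simp: min_def)
      then have "(norm y ^ j * C) * min (norm y) R' \<le> (norm y ^ j * C) * (R' * min 1 (norm y))"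
        using C by (intro mult_left_mono) auto
      then show "norm y ^ j * C * min (norm y) R' \<le> C * R' * (norm y ^ j * min 1 (norm y))"
        by (simp add: mult_ac)
    qed
    also have "\<dots> = ennreal (C * R') * ennreal (norm y ^ j * min 1 (norm y))"
      using C R' by (intro ennreal_mult) auto
    finally show ?thesis .
  qed
  then have "(\<integral>\<^sup>+y. (\<integral>\<^sup>+z. ennreal (indicator {0<..<norm y} z * (norm y - z) ^ j) *
                ennreal \<bar>g (z *\<^sub>R (y /\<^sub>R norm y))\<bar> \<partial>lborel) \<partial>Q)
    \<le> (\<integral>\<^sup>+y. ennreal (C * R') * ennreal (norm y ^ j * min 1 (norm y)) \<partial>Q)"
    by (intro nn_integral_mono)
  also have "\<dots> = ennreal (C * R') * (\<integral>\<^sup>+y. ennreal (norm y ^ j * min 1 (norm y)) \<partial>Q)"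
    by (intro nn_integral_cmult) measurable
  also have "\<dots> < \<infinity>" using fin by (simp add: ennreal_mult_less_top)
  finally show ?thesis .
qed

text \<open>With \<open>j = 0\<close> the weight is the bare indicator of
  \<open>0 < z < norm y\<close>, and the derivative of \<open>f\<close> along the segment from
  \<open>x\<close> to \<open>x + y\<close> integrates to the increment.\<close>

lemma
  fixes f :: "real^'n::finite \<Rightarrow> real" and f' :: "real^'n \<Rightarrow> (real^'n) \<Rightarrow>\<^sub>L real"
  assumes Q: "sigma_finite_measure Q" and sQ: "sets Q = sets borel"
    and fin: "(\<integral>\<^sup>+y. ennreal (min 1 (norm y)) \<partial>Q) < \<infinity>"
    and d: "\<And>z. (f has_derivative f' z) (at z)" and c: "continuous_on UNIV f'"
    and bound: "\<And>z. norm (f' z) \<le> C" and supp: "\<And>z. R < norm z \<Longrightarrow> f' z = 0"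
  shows integrable_first_order: "integrable (radial_image 0 Q) (\<lambda>y. f' (x + y) (y /\<^sub>R norm y))"
    and integrable_increment: "integrable Q (\<lambda>y. f (x + y) - f x)"
    and integral_first_order:
      "(LINT y|radial_image 0 Q. f' (x + y) (y /\<^sub>R norm y)) = (LINT y|Q. f (x + y) - f x)"
proof -
  let ?g = "\<lambda>y. blinfun_apply (f' (x + y)) (y /\<^sub>R norm y)"
  have g [measurable]: "?g \<in> borel_measurable borel"
  proof (rule borel_measurable_continuous_Pair[where H = "\<lambda>z. blinfun_apply (f' z)"])
    show "continuous_on UNIV (\<lambda>p. blinfun_apply (f' (fst p)) (snd p))"
      by (intro continuous_intros continuous_on_compose2[OF c]) auto
  qed measurable
  \<comment> \<open>At \<open>y = 0\<close> the quotient is \<open>0\<close> by the convention for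
    division, hence an inequality.\<close>
  have unit: "norm (y /\<^sub>R norm y) \<le> 1" for y :: "real^'n"
    by (cases "y = 0") auto
  have bnd: "\<bar>?g y\<bar> \<le> C" for y
  proof -
    have "norm (?g y) \<le> norm (f' (x + y)) * norm (y /\<^sub>R norm y)" by (rule norm_blinfun)
    also have "\<dots> \<le> norm (f' (x + y)) * 1" by (intro mult_left_mono unit norm_ge_zero)
    finally show ?thesis using bound[of "x + y"] by simp
  qed
  \<comment> \<open>Translation by \<open>x\<close> enlarges the radius of the support by at most
    \<open>norm x\<close>.\<close>
  have sup: "?g y = 0" if "R + norm x < norm y" for y
  proof -
    have "R < norm (x + y)" using that norm_diff_ineq[of y x] by (simp add: add.commute)
    then show ?thesis using supp by simp
  qed
  have fin': "(\<integral>\<^sup>+y. ennreal (norm y ^ 0 * min 1 (norm y)) \<partial>Q) < \<infinity>" using fin by simp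
  have F: "(\<integral>\<^sup>+y. (\<integral>\<^sup>+z. ennreal (indicator {0<..<norm y} z * (norm y - z) ^ 0) *
      ennreal \<bar>?g (z *\<^sub>R (y /\<^sub>R norm y))\<bar> \<partial>lborel) \<partial>Q) < \<infinity>"
    by (rule radial_integrand_finite[OF sQ fin' bnd sup])
  have rad: "(LINT z|lborel. indicator {0<..<norm y} z * (norm y - z) ^ 0 * ?g (z *\<^sub>R (y /\<^sub>R norm y))) = f (x + y) - f x" for y
  proof (cases "y = 0")
    case False
    define \<xi> where "\<xi> = y /\<^sub>R norm y"
    have y: "y = norm y *\<^sub>R \<xi>" and "norm \<xi> = 1"
      using False by (simp_all add: \<xi>_def)
    \<comment> \<open>In \<open>?g\<close> the direction of differentiation varies with the point;
      along a ray from the origin it is constantly \<open>\<xi>\<close>, which makes the integrand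
      an ordinary derivative in \<open>z\<close>.\<close>
    then have dir: "(z *\<^sub>R \<xi>) /\<^sub>R norm (z *\<^sub>R \<xi>) = \<xi>" if "0 < z" for z
      using that by simp
    have "(LINT z|lborel. indicator {0<..<norm y} z * (norm y - z) ^ 0 * ?g (z *\<^sub>R \<xi>))
        = (LINT z|lborel. indicator {0<..<norm y} z * f' (x + z *\<^sub>R \<xi>) \<xi>)"
      by (intro Bochner_Integration.integral_cong) (use dir in \<open>auto simp: indicator_def simp del: norm_scaleR scaleR_scaleR\<close>)
    also have "\<dots> = f (x + norm y *\<^sub>R \<xi>) - f (x + 0 *\<^sub>R \<xi>)"
    proof (rule integral_FTC_open)
      show "((\<lambda>z. f (x + z *\<^sub>R \<xi>)) has_real_derivative f' (x + z *\<^sub>R \<xi>) \<xi>) (at z)" for z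
        by (rule has_real_derivative_along_line[OF d])
      show "continuous_on UNIV (\<lambda>z. f' (x + z *\<^sub>R \<xi>) \<xi>)"
        by (intro continuous_intros continuous_on_compose2[OF c]) auto
    qed simp
    finally show ?thesis using y by (simp add: \<xi>_def)
  qed simp
  show "integrable (radial_image 0 Q) (\<lambda>y. f' (x + y) (y /\<^sub>R norm y))" by (rule integrable_radial_image[OF Q sQ g F])
  show "integrable Q (\<lambda>y. f (x + y) - f x)"
    using integrable_radial_integral[OF Q sQ g F] unfolding rad .
  show "integral\<^sup>L (radial_image 0 Q) ?g = (LINT y|Q. f (x + y) - f x)"
    using integral_radial_image[OF Q sQ g F] unfolding rad .
qed

text \<open>With \<open>j = 1\<close> the weight \<open>norm y - z\<close> is the kernel of the
  integral form of the second-order Taylor remainder along the segment from \<open>x\<close> to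
  \<open>x + y\<close>.\<close>

lemma
  fixes f :: "real^'n::finite \<Rightarrow> real" and f' :: "real^'n \<Rightarrow> (real^'n) \<Rightarrow>\<^sub>L real"
    and f'' :: "real^'n \<Rightarrow> (real^'n) \<Rightarrow>\<^sub>L (real^'n) \<Rightarrow>\<^sub>L real"
  assumes Q: "sigma_finite_measure Q" and sQ: "sets Q = sets borel"
    and fin: "(\<integral>\<^sup>+y. ennreal (min (norm y) ((norm y)\<^sup>2)) \<partial>Q) < \<infinity>"
    and d: "\<And>z. (f has_derivative f' z) (at z)" and d2: "\<And>z. (f' has_derivative f'' z) (at z)"
    and c: "continuous_on UNIV f''"
    and bound: "\<And>z. norm (f'' z) \<le> C" and supp: "\<And>z. R < norm z \<Longrightarrow> f'' z = 0"
  shows integrable_second_order: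
      "integrable (radial_image 1 Q) (\<lambda>y. f'' (x + y) (y /\<^sub>R norm y) (y /\<^sub>R norm y))"
    and integrable_taylor: "integrable Q (\<lambda>y. f (x + y) - f x - f' x y)"
    and integral_second_order:
      "(LINT y|radial_image 1 Q. f'' (x + y) (y /\<^sub>R norm y) (y /\<^sub>R norm y)) =
       (LINT y|Q. f (x + y) - f x - f' x y)"
proof -
  let ?g = "\<lambda>y. blinfun_apply (blinfun_apply (f'' (x + y)) (y /\<^sub>R norm y)) (y /\<^sub>R norm y)"
  have g [measurable]: "?g \<in> borel_measurable borel"
  proof (rule borel_measurable_continuous_Pair[where H = "\<lambda>z \<xi>. f'' z \<xi> \<xi>"])
    show "continuous_on UNIV (\<lambda>p. blinfun_apply (blinfun_apply (f'' (fst p)) (snd p)) (snd p))"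
      by (intro continuous_intros continuous_on_compose2[OF c]) auto
  qed measurable
  have unit: "norm (y /\<^sub>R norm y) \<le> 1" for y :: "real^'n"
    by (cases "y = 0") auto
  have bnd: "\<bar>?g y\<bar> \<le> C" for y
  proof -
    have "norm (?g y) \<le> norm (f'' (x + y) (y /\<^sub>R norm y)) * norm (y /\<^sub>R norm y)" by (rule norm_blinfun)
    also have "\<dots> \<le> norm (f'' (x + y) (y /\<^sub>R norm y)) * 1" by (intro mult_left_mono unit norm_ge_zero)
    also have "\<dots> \<le> norm (f'' (x + y)) * norm (y /\<^sub>R norm y)" unfolding mult_1_right by (rule norm_blinfun)
    also have "\<dots> \<le> norm (f'' (x + y)) * 1" by (intro mult_left_mono unit norm_ge_zero)
    finally show ?thesis using bound[of "x + y"] by simp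
  qed
  have sup: "?g y = 0" if "R + norm x < norm y" for y
  proof -
    have "R < norm (x + y)" using that norm_diff_ineq[of y x] by (simp add: add.commute)
    then show ?thesis using supp by simp
  qed
  \<comment> \<open>This brings the moment condition into the form with
    \<open>j = 1\<close>.\<close>
  have "norm y ^ 1 * min 1 (norm y) = min (norm y) ((norm y)\<^sup>2)" for y :: "real^'n"
    by (simp add: min_mult_distrib_left power2_eq_square)
  then have fin': "(\<integral>\<^sup>+y. ennreal (norm y ^ 1 * min 1 (norm y)) \<partial>Q) < \<infinity>" using fin by simp
  have F: "(\<integral>\<^sup>+y. (\<integral>\<^sup>+z. ennreal (indicator {0<..<norm y} z * (norm y - z) ^ 1) *
      ennreal \<bar>?g (z *\<^sub>R (y /\<^sub>R norm y))\<bar> \<partial>lborel) \<partial>Q) < \<infinity>"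
    by (rule radial_integrand_finite[OF sQ fin' bnd sup])
  have rad: "(LINT z|lborel. indicator {0<..<norm y} z * (norm y - z) ^ 1 * ?g (z *\<^sub>R (y /\<^sub>R norm y))) = f (x + y) - f x - f' x y" for y
  proof (cases "y = 0")
    case False
    define \<xi> where "\<xi> = y /\<^sub>R norm y"
    have y: "y = norm y *\<^sub>R \<xi>" and "norm \<xi> = 1"
      using False by (simp_all add: \<xi>_def)
    then have dir: "(z *\<^sub>R \<xi>) /\<^sub>R norm (z *\<^sub>R \<xi>) = \<xi>" if "0 < z" for z
      using that by simp
    let ?r = "norm y"
    \<comment> \<open>Antiderivative from integration by parts: the two first-order terms cancel in
      its derivative. At \<open>z = ?r\<close> the first summand vanishes; at \<open>z = 0\<close>
      it is the linear Taylor term.\<close>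
    let ?F = "\<lambda>z. (?r - z) * f' (x + z *\<^sub>R \<xi>) \<xi> + f (x + z *\<^sub>R \<xi>)"
    have "(LINT z|lborel. indicator {0<..<?r} z * (?r - z) ^ 1 * ?g (z *\<^sub>R \<xi>))
        = (LINT z|lborel. indicator {0<..<?r} z * ((?r - z) * f'' (x + z *\<^sub>R \<xi>) \<xi> \<xi>))"
      by (intro Bochner_Integration.integral_cong) (use dir in \<open>auto simp: indicator_def simp del: norm_scaleR scaleR_scaleR\<close>)
    also have "\<dots> = ?F ?r - ?F 0"
    proof (rule integral_FTC_open)
      show "(?F has_real_derivative ((?r - z) * f'' (x + z *\<^sub>R \<xi>) \<xi> \<xi>)) (at z)" for z
      proof -
        have 1: "((\<lambda>z. f (x + z *\<^sub>R \<xi>)) has_real_derivative f' (x + z *\<^sub>R \<xi>) \<xi>) (at z)"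
          by (rule has_real_derivative_along_line[OF d])
        have "((\<lambda>w. f' w \<xi>) has_derivative (\<lambda>h. f'' w h \<xi>)) (at w)" for w
          by (rule bounded_linear.has_derivative[OF blinfun.bounded_linear_left d2])
        from has_real_derivative_along_line[OF this]
        have 2: "((\<lambda>z. f' (x + z *\<^sub>R \<xi>) \<xi>) has_real_derivative f'' (x + z *\<^sub>R \<xi>) \<xi> \<xi>) (at z)" .
        show ?thesis
          by (rule derivative_eq_intros 1 2 refl)+ (simp add: algebra_simps)
      qed
      show "continuous_on UNIV (\<lambda>z. (?r - z) * f'' (x + z *\<^sub>R \<xi>) \<xi> \<xi>)"
        by (intro continuous_intros continuous_on_compose2[OF c]) auto
    qed simp
    also have "\<dots> = f (x + y) - f x - ?r * f' x \<xi>" using y by simp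
    also have "?r * f' x \<xi> = f' x y"
      using y by (metis blinfun.scaleR_right real_scaleR_def)
    finally show ?thesis by (simp only: \<xi>_def)
  qed simp
  show "integrable (radial_image 1 Q) (\<lambda>y. f'' (x + y) (y /\<^sub>R norm y) (y /\<^sub>R norm y))" by (rule integrable_radial_image[OF Q sQ g F])
  show "integrable Q (\<lambda>y. f (x + y) - f x - f' x y)"
    using integrable_radial_integral[OF Q sQ g F] unfolding rad .
  show "integral\<^sup>L (radial_image 1 Q) ?g = (LINT y|Q. f (x + y) - f x - f' x y)"
    using integral_radial_image[OF Q sQ g F] unfolding rad .
qed

subsection \<open>The decomposition formula\<close>

text \<open>The integrand of the Levy condition vanishes only at the origin, a null set.\<close>

lemma levy_measure_sigma_finite:
  fixes M :: "(real^'n::finite) measure"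
  assumes "levy_measure M"
  shows "sigma_finite_measure M"
proof (rule sigma_finite_measure_nn_integral_pos)
  have sM [measurable_cong]: "sets M = sets borel" and z: "emeasure M {0} = 0"
    using assms unfolding levy_measure_def by auto
  show "(\<lambda>y. min 1 ((norm y)\<^sup>2)) \<in> borel_measurable M" by measurable
  show "(\<integral>\<^sup>+y. ennreal (min 1 ((norm y)\<^sup>2)) \<partial>M) < \<infinity>"
    using assms unfolding levy_measure_def by auto
  show "AE y in M. 0 < min 1 ((norm y)\<^sup>2)"
    by (rule AE_I[of _ _ "{0}"]) (auto simp: z sM)
qed

text \<open>Additivity on Borel sets forces the three densities to sum to \<open>1\<close> almost
  everywhere for \<open>K x\<close>; the claim is then linearity of the integral.\<close>

lemma convenient_decomposition_integral:
  fixes u :: "real^'n::finite \<Rightarrow> real"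
  assumes K: "levy_measure (K x)" and dec: "convenient_decomposition K \<nu> \<mu> \<rho>"
    and u: "u \<in> borel_measurable borel"
    and int: "integrable (\<nu> x) u" "integrable (\<mu> x) u" "integrable (\<rho> x) u"
  shows "integral\<^sup>L (K x) u = integral\<^sup>L (\<nu> x) u + integral\<^sup>L (\<mu> x) u + integral\<^sup>L (\<rho> x) u"
proof -
  let ?M = "K x"
  interpret sigma_finite_measure ?M using K by (rule levy_measure_sigma_finite)
  have sM [measurable_cong]: "sets ?M = sets borel"
    using K unfolding levy_measure_def by auto
  note [measurable] = u
  obtain h1 h2 h3 :: "real^'n \<Rightarrow> real"
    where c: "continuous_on UNIV h1" "continuous_on UNIV h2" "continuous_on UNIV h3"
      and nn: "\<And>y. 0 \<le> h1 y" "\<And>y. 0 \<le> h2 y" "\<And>y. 0 \<le> h3 y"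
      and eq: "\<nu> x = density ?M (\<lambda>y. ennreal (h1 y))" "\<mu> x = density ?M (\<lambda>y. ennreal (h2 y))"
        "\<rho> x = density ?M (\<lambda>y. ennreal (h3 y))"
    using dec unfolding convenient_decomposition_def by blast
  have sum: "emeasure ?M B = emeasure (\<nu> x) B + emeasure (\<mu> x) B + emeasure (\<rho> x) B" if "B \<in> sets borel" for B
    using dec that unfolding convenient_decomposition_def by blast
  have [measurable]: "h1 \<in> borel_measurable borel" "h2 \<in> borel_measurable borel" "h3 \<in> borel_measurable borel"
    using c by (auto intro: borel_measurable_continuous_onI)
  \<comment> \<open>Viewing \<open>K x\<close> as its own density with constant \<open>1\<close>
    reduces additivity to the uniqueness of densities.\<close>
  have "density ?M (\<lambda>y. ennreal (h1 y + h2 y + h3 y)) = density ?M (\<lambda>_. 1)"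
  proof (rule measure_eqI)
    fix B assume "B \<in> sets (density ?M (\<lambda>y. ennreal (h1 y + h2 y + h3 y)))"
    then have [measurable]: "B \<in> sets borel" by (simp add: sM)
    have "emeasure (density ?M (\<lambda>y. ennreal (h1 y + h2 y + h3 y))) B
        = emeasure (\<nu> x) B + emeasure (\<mu> x) B + emeasure (\<rho> x) B"
      by (simp add: eq emeasure_density ennreal_plus nn distrib_right nn_integral_add sM)
    also have "\<dots> = emeasure (density ?M (\<lambda>_. 1)) B"
      by (simp add: sum density_1)
    finally show "emeasure (density ?M (\<lambda>y. ennreal (h1 y + h2 y + h3 y))) B = emeasure (density ?M (\<lambda>_. 1)) B" .
  qed simp
  then have "AE y in ?M. ennreal (h1 y + h2 y + h3 y) = 1"
    by (intro density_unique) auto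
  then have ae: "AE y in ?M. h1 y + h2 y + h3 y = 1"
    by eventually_elim (simp only: ennreal_eq_1)
  have i: "integrable ?M (\<lambda>y. h1 y * u y)" "integrable ?M (\<lambda>y. h2 y * u y)" "integrable ?M (\<lambda>y. h3 y * u y)"
    using int by (simp_all add: eq integrable_density nn)
  have "integral\<^sup>L (\<nu> x) u + integral\<^sup>L (\<mu> x) u + integral\<^sup>L (\<rho> x) u
      = (LINT y|?M. h1 y * u y + h2 y * u y + h3 y * u y)"
    using i by (simp add: eq integral_density nn)
  also have "\<dots> = (LINT y|?M. u y)"
  proof (rule integral_cong_AE)
    show "AE y in ?M. h1 y * u y + h2 y * u y + h3 y * u y = u y"
      using ae by eventually_elim (metis distrib_right mult_1)
  qed measurable
  finally show ?thesis by simp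
qed

theorem lemma3p6:
  fixes E D :: "(real^'n::finite \<Rightarrow> real) set"
    and N :: "(real^'n \<Rightarrow> real) \<Rightarrow> real"
    and A :: "(real^'n \<Rightarrow> real) \<Rightarrow> (real^'n \<Rightarrow> real)"
    and a :: "real^'n \<Rightarrow> real^'n"
    and b :: "real^'n \<Rightarrow> real^'n^'n"
    and K \<nu> \<mu> \<rho> \<mu>_tail \<rho>_tail2 :: "real^'n \<Rightarrow> (real^'n) measure"
    and f :: "real^'n \<Rightarrow> real"
    and x :: "real^'n"
  assumes "levy_type_operator E N D A a b K"
    and "convenient_decomposition K \<nu> \<mu> \<rho>"
    and "integrated_radial_tail \<mu> \<mu>_tail"
    and "double_integrated_radial_tail \<rho> \<rho>_tail2"
    and "f \<in> C2c \<inter> D"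
  shows "set_integrable (\<nu> x) {y. norm y < 1} (\<lambda>y. y) \<and>
    set_integrable (\<mu> x) {y. norm y < 1} (\<lambda>y. y) \<and>
    set_integrable (\<rho> x) {y. norm y \<ge> 1} (\<lambda>y. y) \<and>
    integrable (\<nu> x) (\<lambda>y. f (x + y)) \<and>
    integrable (\<mu>_tail x) (\<lambda>y. dir_deriv (y /\<^sub>R norm y) f (x + y)) \<and>
    integrable (\<rho>_tail2 x)
      (\<lambda>y. dir_deriv (y /\<^sub>R norm y) (dir_deriv (y /\<^sub>R norm y) f) (x + y)) \<and>
    A f x =
      (a x + drift_correction \<nu> \<mu> \<rho> x) \<bullet> grad f x
      + 1/2 * div_grad b f x
      + (LINT y|\<nu> x. f (x + y)) - f x * measure (\<nu> x) UNIV
      + (LINT y|\<mu>_tail x. dir_deriv (y /\<^sub>R norm y) f (x + y))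
      + (LINT y|\<rho>_tail2 x. dir_deriv (y /\<^sub>R norm y) (dir_deriv (y /\<^sub>R norm y) f) (x + y))"
proof -
  note dec = assms(2)
  have K: "levy_measure (K x)"
    using assms(1) unfolding levy_type_operator_def levy_triplet_def levy_kernel_def by blast
  then have sK: "sets (K x) = sets borel" and K0: "emeasure (K x) {0} = 0"
    unfolding levy_measure_def by auto
  have Af: "A f x = a x \<bullet> grad f x + 1/2 * div_grad b f x + (LINT y|K x. levy_integrand f x y)"
    using assms(1,5) unfolding levy_type_operator_def by blast
  have sets [measurable_cong]: "sets (\<nu> x) = sets borel" "sets (\<mu> x) = sets borel" "sets (\<rho> x) = sets borel"
    using dec sK unfolding convenient_decomposition_def by (metis sets_density)+
  have sp: "space (\<nu> x) = UNIV" using sets_eq_imp_space_eq[OF sets(1)] by simp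
  \<comment> \<open>\<open>K x\<close> does not charge the origin, so neither do its parts. The
    origin is the only zero of the moment integrands used for sigma-finiteness of
    \<open>\<mu> x\<close> and \<open>\<rho> x\<close>.\<close>
  have "emeasure (\<nu> x) {0} + emeasure (\<mu> x) {0} + emeasure (\<rho> x) {0} = 0"
    using dec K0 unfolding convenient_decomposition_def by (metis borel_singleton sets.empty_sets)
  then have z: "emeasure (\<mu> x) {0} = 0" "emeasure (\<rho> x) {0} = 0" by auto
  have fin: "emeasure (\<nu> x) UNIV < \<infinity>"
    "(\<integral>\<^sup>+y. ennreal (min 1 (norm y)) \<partial>\<mu> x) < \<infinity>"
    "(\<integral>\<^sup>+y. ennreal (min (norm y) ((norm y)\<^sup>2)) \<partial>\<rho> x) < \<infinity>"
    using dec unfolding convenient_decomposition_def by blast+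
  interpret nu: finite_measure "\<nu> x"
    by (rule finite_measureI) (use fin(1) sp in auto)
  have sf\<mu>: "sigma_finite_measure (\<mu> x)"
    by (rule sigma_finite_measure_nn_integral_pos[OF _ fin(2)])
      (auto intro!: AE_I[of _ _ "{0}"] simp: z sets)
  have sf\<rho>: "sigma_finite_measure (\<rho> x)"
    by (rule sigma_finite_measure_nn_integral_pos[OF _ fin(3)])
      (auto intro!: AE_I[of _ _ "{0}"] simp: z sets)
  have \<mu>T: "\<mu>_tail x = radial_image 0 (\<mu> x)"
    by (rule integrated_radial_tail_eq[OF assms(3) sets(2)])
  have \<rho>T: "\<rho>_tail2 x = radial_image 1 (\<rho> x)"
    by (rule double_integrated_radial_tail_eq[OF assms(4) sets(3)])

  obtain f' :: "real^'n \<Rightarrow> (real^'n) \<Rightarrow>\<^sub>L real" and f'' :: "real^'n \<Rightarrow> (real^'n) \<Rightarrow>\<^sub>L ((real^'n) \<Rightarrow>\<^sub>L real)"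
    and C R :: real
    where d1: "\<And>z. (f has_derivative f' z) (at z)" and d2: "\<And>z. (f' has_derivative f'' z) (at z)"
    and c1: "continuous_on UNIV f'" and c2: "continuous_on UNIV f''"
    and C: "\<And>z. \<bar>f z\<bar> \<le> C" "\<And>z. norm (f' z) \<le> C" "\<And>z. norm (f'' z) \<le> C"
    and R: "\<And>z. R < norm z \<Longrightarrow> f' z = 0" "\<And>z. R < norm z \<Longrightarrow> f'' z = 0"
    using C2c_E[of f] assms(5) by blast
  have f_meas [measurable]: "f \<in> borel_measurable borel"
    by (intro borel_measurable_continuous_onI has_derivative_continuous_on)
      (rule has_derivative_at_withinI[OF d1])
  \<comment> \<open>An equation between functions for a fixed direction, so that the inner
    derivative of the iterated \<open>dir_deriv\<close> can be rewritten before \<open>\<xi>\<close>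
    becomes \<open>y /\<^sub>R norm y\<close>.\<close>
  have dd1: "dir_deriv \<xi> f = (\<lambda>z. f' z \<xi>)" for \<xi>
    by (rule ext) (rule dir_deriv_eq[OF d1])
  have dd2: "dir_deriv \<xi> (\<lambda>z. f' z \<xi>) = (\<lambda>z. f'' z \<xi> \<xi>)" for \<xi>
    by (rule ext, rule dir_deriv_eq) (rule bounded_linear.has_derivative[OF blinfun.bounded_linear_left d2])
  have grad: "f' x y = y \<bullet> grad f x" for y
    using fun_cong[OF dd1, of y x] by (simp add: dir_deriv_def)

  \<comment> \<open>Integrability of the drift terms and of \<open>f\<close> against
    \<open>\<nu>\<close>\<close>
  have int\<nu>: "set_integrable (\<nu> x) {y. norm y < 1} (\<lambda>y. y)"
    unfolding set_integrable_def
    by (rule nu.integrable_const_bound[of _ 1]) (auto simp: indicator_def)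
  have int\<mu>: "set_integrable (\<mu> x) {y. norm y < 1} (\<lambda>y. y)"
    unfolding set_integrable_def
  proof (rule Bochner_Integration.integrable_bound)
    show "integrable (\<mu> x) (\<lambda>y. min 1 (norm y))"
      using fin(2) by (intro integrableI_bounded) auto
  qed (auto simp: indicator_def)
  have int\<rho>: "set_integrable (\<rho> x) {y. norm y \<ge> 1} (\<lambda>y. y)"
    unfolding set_integrable_def
  proof (rule Bochner_Integration.integrable_bound)
    show "integrable (\<rho> x) (\<lambda>y. min (norm y) ((norm y)\<^sup>2))"
      using fin(3) by (intro integrableI_bounded) auto
    \<comment> \<open>Outside the unit ball the minimum in the moment of \<open>\<rho>\<close> is
      therefore \<open>norm y\<close>, which dominates the drift integrand.\<close>
    have "norm y \<le> (norm y)\<^sup>2" if "1 \<le> norm y" for y :: "real^'n"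
      using mult_left_mono[OF that norm_ge_zero[of y]] by (simp add: power2_eq_square)
    then show "AE y in \<rho> x. norm (indicat_real {y. 1 \<le> norm y} y *\<^sub>R y) \<le> norm (min (norm y) ((norm y)\<^sup>2))"
      by (auto simp: indicator_def)
  qed measurable
  have intf: "integrable (\<nu> x) (\<lambda>y. f (x + y))"
    by (rule nu.integrable_const_bound[of _ C]) (auto simp: C)

  \<comment> \<open>Taylor remainders against \<open>\<mu>\<close> and \<open>\<rho>\<close>\<close>
  have first: "integrable (radial_image 0 (\<mu> x)) (\<lambda>y. f' (x + y) (y /\<^sub>R norm y))"
    "integrable (\<mu> x) (\<lambda>y. f (x + y) - f x)"
    "(LINT y|radial_image 0 (\<mu> x). f' (x + y) (y /\<^sub>R norm y)) = (LINT y|\<mu> x. f (x + y) - f x)"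
    by (rule integrable_first_order[OF sf\<mu> sets(2) fin(2) d1 c1 C(2)], erule R(1))
      (rule integrable_increment[OF sf\<mu> sets(2) fin(2) d1 c1 C(2)], erule R(1),
       rule integral_first_order[OF sf\<mu> sets(2) fin(2) d1 c1 C(2)], erule R(1))
  have second: "integrable (radial_image 1 (\<rho> x)) (\<lambda>y. f'' (x + y) (y /\<^sub>R norm y) (y /\<^sub>R norm y))"
    "integrable (\<rho> x) (\<lambda>y. f (x + y) - f x - f' x y)"
    "(LINT y|radial_image 1 (\<rho> x). f'' (x + y) (y /\<^sub>R norm y) (y /\<^sub>R norm y)) =
      (LINT y|\<rho> x. f (x + y) - f x - f' x y)"
    by (rule integrable_second_order[OF sf\<rho> sets(3) fin(3) d1 d2 c2 C(3)], erule R(2))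
      (rule integrable_taylor[OF sf\<rho> sets(3) fin(3) d1 d2 c2 C(3)], erule R(2),
       rule integral_second_order[OF sf\<rho> sets(3) fin(3) d1 d2 c2 C(3)], erule R(2))

  let ?G = "grad f x"
  let ?v = "\<lambda>y::real^'n. indicat_real {y. norm y < 1} y *\<^sub>R y"
  let ?w = "\<lambda>y::real^'n. indicat_real {y. 1 \<le> norm y} y *\<^sub>R y"
  have v: "integrable (\<nu> x) ?v" "integrable (\<mu> x) ?v" and w: "integrable (\<rho> x) ?w"
    using int\<nu> int\<mu> int\<rho> by (simp_all add: set_integrable_def)
  have L\<nu>: "levy_integrand f x = (\<lambda>y. f (x + y) - f x - ?v y \<bullet> ?G)"
    by (simp add: levy_integrand_def fun_eq_iff inner_commute)
  \<comment> \<open>For \<open>\<rho>\<close> the full linear term is subtracted, so the part with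
    \<open>norm y \<ge> 1\<close> is added back. This explains the opposite sign of the
    \<open>\<rho>\<close> term in \<open>drift_correction\<close>.\<close>
  have L\<rho>: "levy_integrand f x = (\<lambda>y. (f (x + y) - f x - f' x y) + ?w y \<bullet> ?G)"
    by (auto simp: levy_integrand_def fun_eq_iff inner_commute grad indicator_def)
  have i\<nu>: "integrable (\<nu> x) (levy_integrand f x)"
    unfolding L\<nu> using intf v(1) by (intro Bochner_Integration.integrable_diff integrable_inner_left) auto
  have i\<mu>: "integrable (\<mu> x) (levy_integrand f x)"
    unfolding L\<nu> 
    by (rule Bochner_Integration.integrable_diff[OF first(2) integrable_inner_left]) (rule v(2))
  have i\<rho>: "integrable (\<rho> x) (levy_integrand f x)"
    unfolding L\<rho> 
    by (rule Bochner_Integration.integrable_add[OF second(2) integrable_inner_left]) (rule w)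
  have "(LINT y|\<nu> x. levy_integrand f x y) =
      (LINT y|\<nu> x. f (x + y)) - f x * measure (\<nu> x) UNIV - (LINT y:{y. norm y < 1}|\<nu> x. y) \<bullet> ?G"
  proof -
    have "(LINT y|\<nu> x. levy_integrand f x y) = (LINT y|\<nu> x. f (x + y) - f x) - (LINT y|\<nu> x. ?v y \<bullet> ?G)"
      unfolding L\<nu> using intf
      by (intro Bochner_Integration.integral_diff integrable_inner_left v(1)) auto
    \<comment> \<open>Finite total mass of \<open>\<nu> x\<close> allows the constant
      \<open>f x\<close> to be integrated separately; against \<open>\<mu>\<close> and
      \<open>\<rho>\<close> the remainders are kept whole.\<close>
    also have "(LINT y|\<nu> x. f (x + y) - f x) = (LINT y|\<nu> x. f (x + y)) - f x * measure (\<nu> x) UNIV"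
      using intf sp by (simp add: mult.commute)
    also have "(LINT y|\<nu> x. ?v y \<bullet> ?G) = (LINT y:{y. norm y < 1}|\<nu> x. y) \<bullet> ?G"
      unfolding set_lebesgue_integral_def using v(1) by (intro integral_inner_left) auto
    finally show ?thesis .
  qed
  moreover have "(LINT y|\<mu> x. levy_integrand f x y) =
      (LINT y|\<mu>_tail x. f' (x + y) (y /\<^sub>R norm y)) - (LINT y:{y. norm y < 1}|\<mu> x. y) \<bullet> ?G"
    unfolding L\<nu> set_lebesgue_integral_def \<mu>T first(3)
    by (simp only: Bochner_Integration.integral_diff[OF first(2) integrable_inner_left[OF v(2)]] integral_inner_left[OF v(2)])
  moreover have "(LINT y|\<rho> x. levy_integrand f x y) =
      (LINT y|\<rho>_tail2 x. f'' (x + y) (y /\<^sub>R norm y) (y /\<^sub>R norm y)) + (LINT y:{y. norm y \<ge> 1}|\<rho> x. y) \<bullet> ?G"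
    unfolding L\<rho> set_lebesgue_integral_def \<rho>T second(3)
    by (simp only: Bochner_Integration.integral_add[OF second(2) integrable_inner_left[OF w]] integral_inner_left[OF w])
  moreover have "levy_integrand f x \<in> borel_measurable borel"
    unfolding L\<nu> by measurable
  from convenient_decomposition_integral[OF K dec this i\<nu> i\<mu> i\<rho>]
  have "(LINT y|K x. levy_integrand f x y) = (LINT y|\<nu> x. levy_integrand f x y) +
      (LINT y|\<mu> x. levy_integrand f x y) + (LINT y|\<rho> x. levy_integrand f x y)" .
  ultimately show ?thesis
    using int\<nu> int\<mu> int\<rho> intf first(1) second(1)
    by (simp add: Af dd1 dd2 \<mu>T \<rho>T drift_correction_def inner_add_left inner_diff_left inner_minus_left)
qed

end
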